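(* Let $1\le p\le\infty$, let $\Omega\subset\mathbb{R}^n$ be a domain and let $u\in L^p(\Omega,E)$. Assume that $\mathcal{A}_w u=0$. Then for $p$-a.e. Green domain $U\Subset\Omega$ $$\int_{\partial U}\mathbb{A}(x,\nu(x))u(x)\,d\sigma(x)+\int_U\big(B(x)-\operatorname{div}\mathbb{A}(x)\big)u(x)\,dx=0 .$$
   Context: $E,F$ are finite-dimensional real Euclidean vector spaces, $\mathcal{L}(E,F)$ the linear maps $E\to F$. A domain is a connected open set. $\mathcal{A}$ is a first order operator $\mathcal{A}u(x)=\sum_{j=1}^nA_j(x)\partial_ju(x)+B(x)u(x)$ with $A_j,B\in C^\infty(\Omega,\mathcal{L}(E,F))$. Its principal symbol is $\mathbb{A}(x,\xi)=\sum_j\xi_jA_j(x)$, $\operatorname{div}\mathbb{A}(x)=\sum_j\partial_jA_j(x)$, and its formal adjoint is $\mathcal{A}^*v=-\sum_jA_j^*\partial_jv+(B^*-\sum_j\partial_jA_j^* )v$. Weak extension: $u\in L^p(\Omega,E)$ is in the domain of $\mathcal{A}_w$ with $\mathcal{A}_wu=v\in L^p(\Omega,F)$ if $\int_\Omega\langle v,\phi\rangle_F\,dx=\int_\Omega\langle u,\mathcal{A}^*\phi\rangle_E\,dx$ for all $\phi\in C^1_0(\Omega,F)$ (compactly supported). Green domain: a bounded connected open set $U\subset\mathbb{R}^n$ for which there exist a finite Borel measure $\sigma\ge0$ on $\partial U$ and a vector-valued Baire (Borel) function $\nu=(\nu_1,\dots,\nu_n)$, defined $\sigma$-a.e. on $\partial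 U$ and of unit length, with $\int_U\partial_j\varphi\,dx=\int_{\partial U}\nu_j\varphi\,d\sigma$ for all $\varphi\in C^1(\overline U)$ and all $j$ ($\sigma$ and $\nu$ are then unique). $U\Subset\Omega$ means that $\overline U$ is a compact subset of $\Omega$. $p$-a.e.: a family $\mathscr{E}$ of Green domains is $p$-exceptional if there is a Borel function $\rho:\mathbb{R}^n\to[0,\infty]$ in $L^p(\mathbb{R}^n)$ with $\int_{\partial U}\rho\,d\sigma=+\infty$ for every $U\in\mathscr{E}$. A property holds for $p$-a.e. Green domain $U\Subset\Omega$ if it holds for all such $U$ outside a $p$-exceptional family. In surface integrals $u$ denotes any fixed Borel representative; the surface integral is defined for $p$-a.e. $U$, and changing the representative changes it only for a $p$-exceptional family. *)

theory Defs
  imports "HOL-Analysis.Analysis"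
begin

definition partial_deriv :: "'n::finite \<Rightarrow> (real^'n \<Rightarrow> 'b::real_normed_vector) \<Rightarrow> real^'n \<Rightarrow> 'b" where
  "partial_deriv j f x = frechet_derivative f (at x) (axis j 1)"

(* C^k on a set S, intended for open S; only the values of f on S matter. *)
fun C_k_on :: "nat \<Rightarrow> (real^'n::finite \<Rightarrow> 'b::real_normed_vector) \<Rightarrow> (real^'n) set \<Rightarrow> bool" where
  "C_k_on 0 f S \<longleftrightarrow> continuous_on S f"
| "C_k_on (Suc k) f S \<longleftrightarrow>
     (\<forall>x\<in>S. f differentiable (at x)) \<and> (\<forall>j. C_k_on k (partial_deriv j f) S)"

definition smooth_on :: "(real^'n::finite \<Rightarrow> 'b::real_normed_vector) \<Rightarrow> (real^'n) set \<Rightarrow> bool" where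
  "smooth_on f S \<longleftrightarrow> (\<forall>k. C_k_on k f S)"

definition C1_compact_support ::
  "(real^'n::finite) set \<Rightarrow> (real^'n \<Rightarrow> 'b::real_normed_vector) \<Rightarrow> bool" where
  "C1_compact_support \<Omega> \<phi> \<longleftrightarrow>
     C_k_on 1 \<phi> \<Omega> \<and> (\<exists>K. compact K \<and> K \<subseteq> \<Omega> \<and> (\<forall>x\<in>\<Omega> - K. \<phi> x = 0))"

(* The functions whose classes make up L^p(\<Omega>), 1 \<le> p \<le> \<infinity>, for Lebesgue measure. *)
definition in_Lp :: "ennreal \<Rightarrow> (real^'n::finite) set \<Rightarrow> (real^'n \<Rightarrow> 'b::euclidean_space) \<Rightarrow> bool" where
  "in_Lp p \<Omega> u \<longleftrightarrow> u \<in> borel_measurable (lebesgue_on \<Omega>) \<and>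
     (if p = \<infinity> then (\<exists>C. AE x in lebesgue_on \<Omega>. norm (u x) \<le> C)
      else (\<integral>\<^sup>+x. ennreal (norm (u x) powr enn2real p) \<partial>lebesgue_on \<Omega>) < \<infinity>)"

(* A first order operator sum_j A_j(x) \<partial>_j + B(x) is given by its coefficient functions A and B. *)

definition principal_symbol ::
  "('n::finite \<Rightarrow> real^'n \<Rightarrow> 'e::euclidean_space \<Rightarrow>\<^sub>L 'f::euclidean_space) \<Rightarrow> real^'n \<Rightarrow> real^'n \<Rightarrow> 'e \<Rightarrow>\<^sub>L 'f" where
  "principal_symbol A x \<xi> = (\<Sum>j\<in>UNIV. (\<xi> $ j) *\<^sub>R A j x)"

definition div_symbol ::
  "('n::finite \<Rightarrow> real^'n \<Rightarrow> 'e::euclidean_space \<Rightarrow>\<^sub>L 'f::euclidean_space) \<Rightarrow> real^'n \<Rightarrow> 'e \<Rightarrow>\<^sub>L 'f" where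
  "div_symbol A x = (\<Sum>j\<in>UNIV. partial_deriv j (A j) x)"

definition blinfun_adjoint ::
  "('e::euclidean_space \<Rightarrow>\<^sub>L 'f::euclidean_space) \<Rightarrow> 'f \<Rightarrow>\<^sub>L 'e" where
  "blinfun_adjoint L = Blinfun (adjoint (blinfun_apply L))"

definition formal_adjoint ::
  "('n::finite \<Rightarrow> real^'n \<Rightarrow> 'e::euclidean_space \<Rightarrow>\<^sub>L 'f::euclidean_space) \<Rightarrow> (real^'n \<Rightarrow> 'e \<Rightarrow>\<^sub>L 'f)
    \<Rightarrow> (real^'n \<Rightarrow> 'f) \<Rightarrow> real^'n \<Rightarrow> 'e" where
  "formal_adjoint A B v x =
     - (\<Sum>j\<in>UNIV. blinfun_adjoint (A j x) (partial_deriv j v x))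
     + (blinfun_adjoint (B x) - (\<Sum>j\<in>UNIV. partial_deriv j (\<lambda>y. blinfun_adjoint (A j y)) x)) (v x)"

(* u lies in the domain of the weak extension on L^p(\<Omega>), and its image there is v. *)
definition weak_extension ::
  "ennreal \<Rightarrow> (real^'n::finite) set
    \<Rightarrow> ('n \<Rightarrow> real^'n \<Rightarrow> 'e::euclidean_space \<Rightarrow>\<^sub>L 'f::euclidean_space) \<Rightarrow> (real^'n \<Rightarrow> 'e \<Rightarrow>\<^sub>L 'f)
    \<Rightarrow> (real^'n \<Rightarrow> 'e) \<Rightarrow> (real^'n \<Rightarrow> 'f) \<Rightarrow> bool" where
  "weak_extension p \<Omega> A B u v \<longleftrightarrow> in_Lp p \<Omega> u \<and> in_Lp p \<Omega> v \<and>
     (\<forall>\<phi>. C1_compact_support \<Omega> \<phi> \<longrightarrow>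
        (\<integral>x. v x \<bullet> \<phi> x \<partial>lebesgue_on \<Omega>) = (\<integral>x. u x \<bullet> formal_adjoint A B \<phi> x \<partial>lebesgue_on \<Omega>))"

(* U is a Green domain with surface measure \<sigma>, a measure on the space frontier U, and normal \<nu>.
   C^1(closure U) is read as: restrictions to closure U of functions of class C^1 on an open
   neighbourhood of closure U. Since \<sigma> is unique and \<nu> is unique \<sigma>-a.e., below it makes no
   difference whether \<sigma> and \<nu> are quantified existentially or universally. *)
definition green_domain ::
  "(real^'n::finite) set \<Rightarrow> (real^'n) measure \<Rightarrow> (real^'n \<Rightarrow> real^'n) \<Rightarrow> bool" where
  "green_domain U \<sigma> \<nu> \<longleftrightarrow>
     bounded U \<and> connected U \<and> open U \<and>
     finite_measure \<sigma> \<and> sets \<sigma> = sets (restrict_space borel (frontier U)) \<and>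
     \<nu> \<in> borel_measurable \<sigma> \<and> (AE x in \<sigma>. norm (\<nu> x) = 1) \<and>
     (\<forall>\<phi> :: real^'n \<Rightarrow> real. (\<exists>W. open W \<and> closure U \<subseteq> W \<and> C_k_on 1 \<phi> W) \<longrightarrow>
        (\<forall>j. (\<integral>x. partial_deriv j \<phi> x \<partial>lebesgue_on U) = (\<integral>x. \<nu> x $ j * \<phi> x \<partial>\<sigma>)))"

(* The condition on \<rho> is membership of L^p(R^n) for a function with values in [0,\<infinity>]. *)
definition p_exceptional :: "ennreal \<Rightarrow> (real^'n::finite) set set \<Rightarrow> bool" where
  "p_exceptional p \<E> \<longleftrightarrow>
     (\<exists>\<rho> :: real^'n \<Rightarrow> ennreal. \<rho> \<in> borel_measurable borel \<and>
        (AE x in lebesgue. \<rho> x \<noteq> \<infinity>) \<and> in_Lp p UNIV (\<lambda>x. enn2real (\<rho> x)) \<and>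
        (\<forall>U\<in>\<E>. \<exists>\<sigma> \<nu>. green_domain U \<sigma> \<nu> \<and> (\<integral>\<^sup>+x. \<rho> x \<partial>\<sigma>) = \<infinity>))"

definition p_ae_green_domain ::
  "ennreal \<Rightarrow> (real^'n::finite) set
    \<Rightarrow> ((real^'n) set \<Rightarrow> (real^'n) measure \<Rightarrow> (real^'n \<Rightarrow> real^'n) \<Rightarrow> bool) \<Rightarrow> bool" where
  "p_ae_green_domain p \<Omega> P \<longleftrightarrow>
     (\<exists>\<E>. p_exceptional p \<E> \<and>
        (\<forall>U \<sigma> \<nu>. green_domain U \<sigma> \<nu> \<and> compact (closure U) \<and> closure U \<subseteq> \<Omega> \<and> U \<notin> \<E>
           \<longrightarrow> P U \<sigma> \<nu>))"

end

theory Submission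
  imports Defs
begin

text \<open>The equation \<open>A\<^sub>w u = 0\<close> may be tested with \<open>\<phi> = (\<eta> * 1\<^sub>U) f\<close>, where \<open>U\<close> is a Green domain,
\<open>\<eta>\<close> an even mollifier of small radius \<open>\<epsilon>\<close>, and \<open>f\<close> a constant vector. The only derivatives that
occur are those of \<open>\<eta> * 1\<^sub>U\<close>, and the formula that defines Green domains, applied to
\<open>y \<mapsto> \<eta> (x - y)\<close>, turns them into surface integrals:
\<open>\<partial>\<^sub>j (\<eta> * 1\<^sub>U) x = - \<integral> \<nu>\<^sub>j y * \<eta> (x - y) d\<sigma>\<close>. By Fubini the weak equation becomes
\[ \int_{\partial U} \sum_j \nu_j (\eta * (A_j u)) d\sigma + \int_U \eta * ((B - div A) u) dx = 0, \]
an identity for every \<open>\<epsilon>\<close> smaller than the distance from \<open>U\<close> to the complement of \<open>\<Omega>\<close>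
(\<open>mollified_green_identity\<close>). The identity is exact because the products \<open>A\<^sub>j u\<close> are mollified as a
whole.

It remains to let \<open>\<epsilon>\<close> tend to \<open>0\<close>. The volume term converges because mollification converges in
\<open>L\<^sup>1\<close>. The surface term is the reason for exceptional families. For \<open>p < \<infinity>\<close> mollifications \<open>g\<^sub>m\<close> of
\<open>g = (A\<^sub>1 u, \<dots>, A\<^sub>n u)\<close> converge in \<open>L\<^sup>p\<close> on compact sets, so along a rapidly convergent choice of
scales all the functions \<open>2\<^sup>m |g\<^sub>m - g|\<close> lie below one function \<open>\<rho>\<close> of \<open>L\<^sup>p\<close> (Fuglede's lemma), and
then \<open>\<integral> |g\<^sub>m - g| d\<sigma> \<le> 2\<^sup>-\<^sup>m \<integral> \<rho> d\<sigma>\<close> tends to \<open>0\<close> whenever \<open>\<integral> \<rho> d\<sigma>\<close> is finite. For \<open>p = \<infinity>\<close>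
there is no convergence in norm, but there is convergence almost everywhere with a uniform bound;
the function \<open>\<rho>\<close> is then \<open>\<infinity>\<close> on the null set where either fails and \<open>0\<close> elsewhere, and dominated
convergence applies to every \<open>\<sigma>\<close> with \<open>\<integral> \<rho> d\<sigma> < \<infinity>\<close>.

The convergence of mollifications in \<open>L\<^sup>p\<close> is reduced to continuity of translations, first in \<open>L\<^sup>1\<close>
and from there in \<open>L\<^sup>p\<close> through the map \<open>v \<mapsto> |v|\<^sup>p\<^sup>-\<^sup>1 v\<close>, which takes \<open>L\<^sup>p\<close> functions to \<open>L\<^sup>1\<close> functions and
controls the \<open>p\<close>-th power of a distance by the distance of the images.\<close>

section \<open>Continuity of translations\<close>

lemma nn_integral_lborel_translate:
  fixes f :: "'a::euclidean_space \<Rightarrow> ennreal"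
  assumes [measurable]: "f \<in> borel_measurable borel"
  shows "(\<integral>\<^sup>+x. f (x + c) \<partial>lborel) = (\<integral>\<^sup>+x. f x \<partial>lborel)"
proof -
  have "(\<integral>\<^sup>+x. f x \<partial>lborel) = (\<integral>\<^sup>+x. f x \<partial>distr lborel borel ((+) c))"
    by (simp add: lborel_distr_plus)
  also have "\<dots> = (\<integral>\<^sup>+x. f (c + x) \<partial>lborel)"
    by (subst nn_integral_distr) auto
  finally show ?thesis by (simp add: add.commute)
qed

lemma integrable_lborel_translate:
  fixes f :: "'a::euclidean_space \<Rightarrow> 'b::{banach, second_countable_topology}"
  assumes "integrable lborel f"
  shows "integrable lborel (\<lambda>x. f (x + c))"
  using assms nn_integral_lborel_translate[of "\<lambda>x. ennreal (norm (f x))" c]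
  unfolding integrable_iff_bounded by auto

lemma integral_lborel_translate:
  fixes f :: "'a::euclidean_space \<Rightarrow> 'b::{banach, second_countable_topology}"
  assumes [measurable]: "f \<in> borel_measurable borel"
  shows "(\<integral>x. f (x + c) \<partial>lborel) = (\<integral>x. f x \<partial>lborel)"
proof -
  have "(\<integral>x. f x \<partial>lborel) = (\<integral>x. f x \<partial>distr lborel borel ((+) c))"
    by (simp add: lborel_distr_plus)
  also have "\<dots> = (\<integral>x. f (c + x) \<partial>lborel)"
    by (subst integral_distr) auto
  finally show ?thesis by (simp add: add.commute)
qed

text \<open>For an open set the part of \<open>U\<close> that a small translation uncovers shrinks to nothing pointwise, so
its measure tends to \<open>0\<close> by dominated convergence. By translation invariance the part that is
newly covered has the same measure.\<close>

lemma open_indicator_translation_L1: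
  fixes U :: "'a::euclidean_space set"
  assumes U: "open U" and fin: "emeasure lborel U < \<infinity>" and z: "z \<longlonglongrightarrow> 0"
  shows "(\<lambda>n. \<integral>x. \<bar>indicat_real U (x + z n) - indicat_real U x\<bar> \<partial>lborel) \<longlonglongrightarrow> 0"
proof -
  have [measurable]: "U \<in> sets borel" using U by simp
  have int: "integrable lborel (indicat_real U)" using fin by simp
  have int': "integrable lborel (\<lambda>x. indicat_real U (x + c))" for c
    by (rule integrable_lborel_translate[OF int])
  have "(\<lambda>n. \<integral>x. max 0 (indicat_real U x - indicat_real U (x + z n)) \<partial>lborel) \<longlonglongrightarrow> (\<integral>x. 0 \<partial>(lborel::'a measure))"
  proof (rule integral_dominated_convergence[where w = "indicat_real U"])
    show "AE x in lborel. (\<lambda>n. max 0 (indicat_real U x - indicat_real U (x + z n))) \<longlonglongrightarrow> 0"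
    proof (rule AE_I2, cases)
      fix x assume "x \<in> U"
      have "(\<lambda>n. x + z n) \<longlonglongrightarrow> x" using tendsto_add[OF tendsto_const z, of x] by simp
      then have "\<forall>\<^sub>F n in sequentially. x + z n \<in> U"
        using U \<open>x \<in> U\<close> by (rule topological_tendstoD)
      then have "\<forall>\<^sub>F n in sequentially. max 0 (indicat_real U x - indicat_real U (x + z n)) = 0"
        by eventually_elim (use \<open>x \<in> U\<close> in simp)
      then show "(\<lambda>n. max 0 (indicat_real U x - indicat_real U (x + z n))) \<longlonglongrightarrow> 0"
        by (rule tendsto_eventually)
    qed simp
  qed (auto simp: int indicator_def)
  moreover have "(\<integral>x. \<bar>indicat_real U (x + c) - indicat_real U x\<bar> \<partial>lborel) =
      2 * (\<integral>x. max 0 (indicat_real U x - indicat_real U (x + c)) \<partial>lborel)" for c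
  proof -
    \<comment> \<open>The identity \<open>|t| = 2 max 0 (- t) + t\<close>; the integral of the last term vanishes.\<close>
    have "(\<integral>x. \<bar>indicat_real U (x + c) - indicat_real U x\<bar> \<partial>lborel) =
      (\<integral>x. 2 * max 0 (indicat_real U x - indicat_real U (x + c)) + (indicat_real U (x + c) - indicat_real U x) \<partial>lborel)"
      by (rule Bochner_Integration.integral_cong) (auto simp: indicator_def)
    also have "\<dots> = (\<integral>x. 2 * max 0 (indicat_real U x - indicat_real U (x + c)) \<partial>lborel) + ((\<integral>x. indicat_real U (x + c) \<partial>lborel) - (\<integral>x. indicat_real U x \<partial>lborel))"
      using int int'[of c]
      by (subst Bochner_Integration.integral_add | subst Bochner_Integration.integral_diff |
         intro Bochner_Integration.integrable_diff integrable_mult_right integrable_max | simp)+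
    also have "(\<integral>x. indicat_real U (x + c) \<partial>lborel) = (\<integral>x. indicat_real U x \<partial>lborel)"
      by (rule integral_lborel_translate) simp
    finally show ?thesis by simp
  qed
  ultimately show ?thesis
    by (simp add: tendsto_mult_right_zero)
qed

text \<open>The claim survives sums and limits in \<open>L\<^sup>1\<close>, and outer regularity replaces a set of finite measure
by an open one at arbitrarily small cost, so open sets suffice.\<close>

lemma L1_continuity_of_translation:
  fixes f :: "'a::euclidean_space \<Rightarrow> 'b::{banach, second_countable_topology}"
  assumes "integrable lborel f" and z: "z \<longlonglongrightarrow> 0"
  shows "(\<lambda>n. \<integral>x. norm (f (x + z n) - f x) \<partial>lborel) \<longlonglongrightarrow> 0"
  using assms(1)
proof induction
  case (base A c)
  have A[measurable]: "A \<in> sets borel" using base by simp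
  have "(\<lambda>n. \<integral>x. \<bar>indicat_real A (x + z n) - indicat_real A x\<bar> \<partial>lborel) \<longlonglongrightarrow> 0"
  proof (rule LIMSEQ_I)
    fix e :: real assume "0 < e"
    obtain U where U: "open U" "A \<subseteq> U" "emeasure lborel (U - A) < ennreal (e / 4)"
      using outer_regular_lborel[OF A, of "e/4"] \<open>0 < e\<close> by auto
    have [measurable]: "U \<in> sets borel" using U by simp
    have "emeasure lborel U \<le> emeasure lborel A + emeasure lborel (U - A)"
      using U(2) by (intro order_trans[OF _ emeasure_subadditive] emeasure_mono) auto
    also have "\<dots> < \<infinity>"
      using base(2) U(3) by (metis ennreal_add_less_top infinity_ennreal_def ennreal_less_top order_less_trans)
    finally have finU: "emeasure lborel U < \<infinity>" .
    have fin: "emeasure lborel (U - A) < \<infinity>" using U(3) by (simp add: order_less_trans)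
    have m: "measure lborel (U - A) < e / 4"
      using U(3) \<open>0 < e\<close> fin by (simp add: emeasure_eq_ennreal_measure[of lborel "U - A"] ennreal_less_iff)
    have int: "integrable lborel (indicat_real A)" "integrable lborel (indicat_real U)" "integrable lborel (indicat_real (U - A))"
      using base(2) finU fin by auto
    note int' = int[THEN integrable_lborel_translate]
    from open_indicator_translation_L1[OF U(1) finU z, THEN LIMSEQ_D, of "e/2"] \<open>0 < e\<close>
    obtain N where N: "\<And>n. n \<ge> N \<Longrightarrow> \<bar>\<integral>x. \<bar>indicat_real U (x + z n) - indicat_real U x\<bar> \<partial>lborel\<bar> < e / 2"
      by auto
    show "\<exists>no. \<forall>n\<ge>no. norm ((\<integral>x. \<bar>indicat_real A (x + z n) - indicat_real A x\<bar> \<partial>lborel) - 0) < e"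
    proof (intro exI[of _ N] allI impI)
      fix n assume n: "N \<le> n"
      have "(\<integral>x. \<bar>indicat_real A (x + z n) - indicat_real A x\<bar> \<partial>lborel)
        \<le> (\<integral>x. \<bar>indicat_real U (x + z n) - indicat_real U x\<bar> + (indicat_real (U - A) (x + z n) + indicat_real (U - A) x) \<partial>lborel)"
        using U(2)
        by (intro integral_mono Bochner_Integration.integrable_add integrable_abs Bochner_Integration.integrable_diff int int')
           (auto simp: indicator_def)
      also have "\<dots> = (\<integral>x. \<bar>indicat_real U (x + z n) - indicat_real U x\<bar> \<partial>lborel) + ((\<integral>x. indicat_real (U - A) (x + z n) \<partial>lborel) + (\<integral>x. indicat_real (U - A) x \<partial>lborel))"
        using int int'
        by (simp add: Bochner_Integration.integral_add)
      also have "(\<integral>x. indicat_real (U - A) (x + z n) \<partial>lborel) = (\<integral>x. indicat_real (U - A) x \<partial>lborel)"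
        by (rule integral_lborel_translate) simp
      also have "(\<integral>x. indicat_real (U - A) x \<partial>lborel) = measure lborel (U - A)"
        by simp
      finally have "(\<integral>x. \<bar>indicat_real A (x + z n) - indicat_real A x\<bar> \<partial>lborel) < e"
        using N[OF n] m by linarith
      moreover have "0 \<le> (\<integral>x. \<bar>indicat_real A (x + z n) - indicat_real A x\<bar> \<partial>lborel)" by simp
      ultimately show "norm ((\<integral>x. \<bar>indicat_real A (x + z n) - indicat_real A x\<bar> \<partial>lborel) - 0) < e"
        by simp
    qed
  qed
  from tendsto_mult_left_zero[OF this, of "norm c"]
  show ?case by (simp flip: scaleR_diff_left)
next
  case (add f g)
  note i = add.hyps
  note i' = i[THEN integrable_lborel_translate]
  from tendsto_add[OF add.IH]
  have "(\<lambda>n. (\<integral>x. norm (f (x + z n) - f x) \<partial>lborel) + (\<integral>x. norm (g (x + z n) - g x) \<partial>lborel)) \<longlonglongrightarrow> 0"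
    by simp
  then show ?case
  proof (rule Lim_null_comparison[rotated], intro always_eventually allI)
    fix n
    have "(\<integral>x. norm (f (x + z n) + g (x + z n) - (f x + g x)) \<partial>lborel)
      \<le> (\<integral>x. norm (f (x + z n) - f x) + norm (g (x + z n) - g x) \<partial>lborel)"
      using i i' by (intro integral_mono Bochner_Integration.integrable_add integrable_norm
         Bochner_Integration.integrable_diff) (auto intro: norm_diff_triangle_ineq)
    then show "norm (\<integral>x. norm (f (x + z n) + g (x + z n) - (f x + g x)) \<partial>lborel)
      \<le> (\<integral>x. norm (f (x + z n) - f x) \<partial>lborel) + (\<integral>x. norm (g (x + z n) - g x) \<partial>lborel)"
      using i i' by simp
  qed
next
  case (lim f s)
  have conv: "(\<lambda>i. \<integral>x. norm (s i x - f x) \<partial>lborel) \<longlonglongrightarrow> (\<integral>x. 0 \<partial>(lborel::'a measure))"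
  proof (rule integral_dominated_convergence[where w = "\<lambda>x. 3 * norm (f x)"])
    show "AE x in lborel. (\<lambda>i. norm (s i x - f x)) \<longlonglongrightarrow> 0"
      using lim.hyps(2) by (auto simp: tendsto_norm_zero_iff LIM_zero_iff)
    show "AE x in lborel. norm (norm (s i x - f x)) \<le> 3 * norm (f x)" for i
    proof (rule AE_I2)
      fix x
      show "norm (norm (s i x - f x)) \<le> 3 * norm (f x)"
        using lim.hyps(3)[of x i] norm_triangle_ineq4[of "s i x" "f x"] by simp
    qed
  qed (use lim.hyps in auto)
  show ?case
  proof (rule LIMSEQ_I)
    fix e :: real assume "0 < e"
    from conv[THEN LIMSEQ_D, of "e/4"] \<open>0 < e\<close>
    obtain i where i: "(\<integral>x. norm (s i x - f x) \<partial>lborel) < e / 4"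
      by (auto dest: spec[of _ "n::nat" for n])
    from lim.IH[of i, THEN LIMSEQ_D, of "e/2"] \<open>0 < e\<close>
    obtain N where N: "\<And>n. n \<ge> N \<Longrightarrow> (\<integral>x. norm (s i (x + z n) - s i x) \<partial>lborel) < e / 2"
      by auto
    note ii = lim.hyps(1)[of i] lim.hyps(4)
    note ii' = ii[THEN integrable_lborel_translate]
    have id: "integrable lborel (\<lambda>x. norm (s i x - f x))" using ii by simp
    have meas: "(\<lambda>x. norm (s i x - f x)) \<in> borel_measurable borel" using id by auto
    show "\<exists>no. \<forall>n\<ge>no. norm ((\<integral>x. norm (f (x + z n) - f x) \<partial>lborel) - 0) < e"
    proof (intro exI[of _ N] allI impI)
      fix n assume n: "N \<le> n"
      have "(\<integral>x. norm (f (x + z n) - f x) \<partial>lborel)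
        \<le> (\<integral>x. norm (s i (x + z n) - s i x) + (norm (s i (x + z n) - f (x + z n)) + norm (s i x - f x)) \<partial>lborel)"
      proof (intro integral_mono Bochner_Integration.integrable_add integrable_norm
           Bochner_Integration.integrable_diff ii ii')
        fix x
        have *: "norm (b - d) \<le> norm (a - c) + (norm (a - b) + norm (c - d))" for a b c d :: 'b
          using norm_triangle_ineq4[of "a - c" "(a - b) - (c - d)"] norm_triangle_ineq4[of "a - b" "c - d"] by (simp add: algebra_simps)
        show "norm (f (x + z n) - f x) \<le> norm (s i (x + z n) - s i x) + (norm (s i (x + z n) - f (x + z n)) + norm (s i x - f x))"
          by (rule *)
      qed
      also have "\<dots> = (\<integral>x. norm (s i (x + z n) - s i x) \<partial>lborel) + ((\<integral>x. norm (s i (x + z n) - f (x + z n)) \<partial>lborel) + (\<integral>x. norm (s i x - f x) \<partial>lborel))"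
        using ii ii' by simp
      also have "(\<integral>x. norm (s i (x + z n) - f (x + z n)) \<partial>lborel) = (\<integral>x. norm (s i x - f x) \<partial>lborel)"
        using integral_lborel_translate[OF meas] .
      finally have "(\<integral>x. norm (f (x + z n) - f x) \<partial>lborel) < e"
        using N[OF n] i by linarith
      then show "norm ((\<integral>x. norm (f (x + z n) - f x) \<partial>lborel) - 0) < e" by simp
    qed
  qed
qed

text \<open>Composition with \<open>v \<mapsto> |v|\<^sup>p\<^sup>-\<^sup>1 v\<close> takes \<open>L\<^sup>p\<close> functions to \<open>L\<^sup>1\<close> functions and commutes with
translations, which brings the case of general \<open>p\<close> back to \<open>p = 1\<close>.\<close>

definition power_map :: "real \<Rightarrow> 'a::real_normed_vector \<Rightarrow> 'a" where
  "power_map p v = norm v powr (p - 1) *\<^sub>R v"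

lemma norm_power_map: "norm (power_map p v) = norm v powr p"
proof (cases "v = 0")
  case False
  then show ?thesis by (simp add: power_map_def powr_mult_base mult.commute)
qed (simp add: power_map_def)

text \<open>Write \<open>T\<close> for \<open>power_map p\<close>, \<open>s = |a|\<^sup>p\<^sup>-\<^sup>1\<close>, \<open>t = |b|\<^sup>p\<^sup>-\<^sup>1\<close> and \<open>r = |a - b|\<close>. Then
\<open>2 (T a - T b) \<bullet> (a - b) = (s + t) r\<^sup>2 + (s - t) (|a|\<^sup>2 - |b|\<^sup>2)\<close>. The last term is nonnegative, and one
of \<open>a\<close>, \<open>b\<close> has norm at least \<open>r / 2\<close>; the left-hand side is at most
\<open>2 |T a - T b| r\<close> by Cauchy-Schwarz.\<close>

lemma power_map_expansive:
  fixes a b :: "'a::real_inner"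
  assumes "1 \<le> p"
  shows "norm (a - b) powr p \<le> 2 powr p * norm (power_map p a - power_map p b)"
proof (cases "a = b")
  case False
  define s t r where "s = norm a powr (p - 1)" and "t = norm b powr (p - 1)" and "r = norm (a - b)"
  have "0 < r" using False by (simp add: r_def)
  have mono: "0 \<le> (s - t) * ((norm a)\<^sup>2 - (norm b)\<^sup>2)"
  proof (cases "norm a \<le> norm b")
    case True
    then have "s \<le> t" "(norm a)\<^sup>2 \<le> (norm b)\<^sup>2"
      using assms by (auto simp: s_def t_def intro!: powr_mono2 power_mono)
    then show ?thesis by (simp add: mult_nonpos_nonpos)
  next
    case False
    then have "t \<le> s" "(norm b)\<^sup>2 \<le> (norm a)\<^sup>2"
      using assms by (auto simp: s_def t_def intro!: powr_mono2 power_mono)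
    then show ?thesis by simp
  qed
  have st: "(r / 2) powr (p - 1) \<le> s + t"
  proof -
    have "r / 2 \<le> norm a \<or> r / 2 \<le> norm b"
      using norm_triangle_ineq4[of a b] by (auto simp: r_def)
    then have "(r / 2) powr (p - 1) \<le> s \<or> (r / 2) powr (p - 1) \<le> t"
      using assms \<open>0 < r\<close> by (auto simp: s_def t_def intro!: powr_mono2)
    moreover have "0 \<le> s" "0 \<le> t" by (auto simp: s_def t_def)
    ultimately show ?thesis by linarith
  qed
  have "(r / 2) powr (p - 1) * r\<^sup>2 / 2 \<le> (s + t) * r\<^sup>2 / 2"
    using st by (simp add: mult_right_mono)
  also have "\<dots> \<le> (s + t) * r\<^sup>2 / 2 + (s - t) * ((norm a)\<^sup>2 - (norm b)\<^sup>2) / 2"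
    using mono by simp
  also have "\<dots> = (power_map p a - power_map p b) \<bullet> (a - b)"
    unfolding r_def power_map_def s_def[symmetric] t_def[symmetric] dot_square_norm[symmetric]
    by (simp add: inner_diff_left inner_diff_right inner_commute algebra_simps)
       (simp add: field_simps)
  also have "\<dots> \<le> norm (power_map p a - power_map p b) * r"
    unfolding r_def by (rule norm_cauchy_schwarz)
  finally have "((r / 2) powr (p - 1) * (r / 2)) * r \<le> norm (power_map p a - power_map p b) * r"
    by (simp add: power2_eq_square)
  then have "(r / 2) powr (p - 1) * (r / 2) \<le> norm (power_map p a - power_map p b)"
    using \<open>0 < r\<close> by simp
  moreover have "(r / 2) powr (p - 1) * (r / 2) = r powr p / 2 powr p"
    using \<open>0 < r\<close> by (subst mult.commute, subst powr_mult_base) (auto simp: powr_divide)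
  ultimately have "r powr p / 2 powr p \<le> norm (power_map p a - power_map p b)"
    by (simp only:)
  then show ?thesis
    by (simp add: r_def[symmetric] pos_divide_le_eq mult.commute)
qed simp

text \<open>The inequality for \<open>power_map\<close> bounds the \<open>p\<close>-th power of the \<open>L\<^sup>p\<close> distance between \<open>g\<close> and a
translate by the \<open>L\<^sup>1\<close> distance between \<open>power_map p \<circ> g\<close> and its translate.\<close>

lemma Lp_continuity_of_translation:
  fixes g :: "'a::euclidean_space \<Rightarrow> 'b::euclidean_space"
  assumes [measurable]: "g \<in> borel_measurable borel" and "1 \<le> p"
    and fin: "(\<integral>\<^sup>+x. ennreal (norm (g x) powr p) \<partial>lborel) < \<infinity>" and "0 < e"
  shows "\<exists>d>0. \<forall>z. norm z \<le> d \<longrightarrow> (\<integral>\<^sup>+x. ennreal (norm (g (x + z) - g x) powr p) \<partial>lborel) \<le> ennreal e"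
proof (rule ccontr)
  define I where "I z = (\<integral>\<^sup>+x. ennreal (norm (g (x + z) - g x) powr p) \<partial>lborel)" for z
  assume "\<not> ?thesis"
  then have "\<exists>z. norm z \<le> d \<and> ennreal e < I z" if "0 < d" for d
    using that by (auto simp: I_def not_le)
  then have "\<exists>z. norm z \<le> inverse (real (Suc n)) \<and> ennreal e < I z" for n
    by simp
  then obtain z where z: "\<And>n. norm (z n) \<le> inverse (real (Suc n))" "\<And>n. ennreal e < I (z n)"
    by metis
  have z0: "z \<longlonglongrightarrow> 0"
    by (rule Lim_null_comparison[OF _ LIMSEQ_inverse_real_of_nat]) (use z in simp)
  have mT[measurable]: "power_map p \<in> borel_measurable (borel :: 'b measure)"
    unfolding power_map_def by measurable
  have int: "integrable lborel (\<lambda>x. power_map p (g x))"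
    using fin by (auto simp: integrable_iff_bounded norm_power_map)
  note int' = integrable_lborel_translate[OF int]
  have "I (z n) \<le> ennreal (2 powr p * (\<integral>x. norm (power_map p (g (x + z n)) - power_map p (g x)) \<partial>lborel))" for n
  proof -
    have "I (z n) \<le> (\<integral>\<^sup>+x. ennreal (2 powr p * norm (power_map p (g (x + z n)) - power_map p (g x))) \<partial>lborel)"
      unfolding I_def by (intro nn_integral_mono ennreal_leI power_map_expansive \<open>1 \<le> p\<close>)
    also have "\<dots> = ennreal (\<integral>x. 2 powr p * norm (power_map p (g (x + z n)) - power_map p (g x)) \<partial>lborel)"
      using int int' by (intro nn_integral_eq_integral) auto
    finally show ?thesis by simp
  qed
  moreover have "(\<lambda>n. 2 powr p * (\<integral>x. norm (power_map p (g (x + z n)) - power_map p (g x)) \<partial>lborel)) \<longlonglongrightarrow> 0"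
    by (intro tendsto_mult_right_zero L1_continuity_of_translation[OF int z0])
  then obtain n where "2 powr p * (\<integral>x. norm (power_map p (g (x + z n)) - power_map p (g x)) \<partial>lborel) < e"
    using \<open>0 < e\<close> by (metis (no_types, lifting) eventually_sequentially order_refl order_tendstoD(2))
  ultimately show False
    using z(2)[of n] by (meson ennreal_leI leD less_imp_le order_less_le_trans)
qed

section \<open>Mollification\<close>

text \<open>With \<open>s\<close> the mean of \<open>h\<close>, Young's inequality \<open>h s\<^sup>p\<^sup>-\<^sup>1 \<le> h\<^sup>p / p + s\<^sup>p / q\<close> is the tangent line inequality
for the \<open>p\<close>-th power at \<open>s\<close>; its mean is the claim. The right-hand side is a nonnegative integral,
so that the case of a nonintegrable \<open>h\<^sup>p\<close> is included.\<close>

lemma jensen_powr_nn_integral: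
  fixes w h :: "'a \<Rightarrow> real"
  assumes [measurable]: "w \<in> borel_measurable M" "h \<in> borel_measurable M"
    and "\<And>x. 0 \<le> w x" "\<And>x. 0 \<le> h x"
    and w: "integrable M w" "(\<integral>x. w x \<partial>M) = 1" and wh: "integrable M (\<lambda>x. w x * h x)" and "1 \<le> p"
  shows "ennreal ((\<integral>x. w x * h x \<partial>M) powr p) \<le> (\<integral>\<^sup>+x. ennreal (w x * h x powr p) \<partial>M)"
proof (cases "(\<integral>\<^sup>+x. ennreal (w x * h x powr p) \<partial>M) = \<infinity>")
  case False
  have whp: "integrable M (\<lambda>x. w x * h x powr p)"
    using False assms(3,4) by (auto simp: integrable_iff_bounded less_top)
  define s where "s = (\<integral>x. w x * h x \<partial>M)"
  have "0 \<le> s" unfolding s_def using assms(3,4) by simp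
  have "s powr p \<le> (\<integral>x. w x * h x powr p \<partial>M)"
  proof (cases "s = 0 \<or> p = 1")
    case True
    then show ?thesis
    proof
      assume "p = 1"
      then show ?thesis using assms(3,4) \<open>0 \<le> s\<close> by (simp add: s_def)
    qed (use assms(3,4) in simp)
  next
    case False
    then have "0 < s" "1 < p" using \<open>0 \<le> s\<close> \<open>1 \<le> p\<close> by auto
    define q where "q = p / (p - 1)"
    have q: "1 < q" "1 / p + 1 / q = 1" "(p - 1) * q = p"
      using \<open>1 < p\<close> by (auto simp: q_def field_simps)
    have young: "h x * s powr (p - 1) \<le> h x powr p / p + s powr p / q" for x
      using Youngs_inequality[OF \<open>1 < p\<close> q(1,2) assms(4), of "s powr (p - 1)" x] q(3)
      by (simp add: powr_powr)
    have "s powr p = (\<integral>x. (w x * h x) * s powr (p - 1) \<partial>M)"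
      using \<open>0 < s\<close> by (simp add: s_def[symmetric] powr_mult_base)
    also have "\<dots> \<le> (\<integral>x. (w x * h x powr p) / p + w x * (s powr p / q) \<partial>M)"
    proof (rule integral_mono)
      fix x
      show "w x * h x * s powr (p - 1) \<le> (w x * h x powr p) / p + w x * (s powr p / q)"
        using mult_left_mono[OF young[of x] assms(3)[of x]] by (simp add: algebra_simps)
    qed (use wh whp w in auto)
    also have "\<dots> = (\<integral>x. w x * h x powr p \<partial>M) / p + s powr p / q"
      using whp w by simp
    finally have "s powr p * (1 - 1 / q) \<le> (\<integral>x. w x * h x powr p \<partial>M) / p"
      by (simp add: algebra_simps)
    moreover have "1 - 1 / q = 1 / p" using q(2) by simp
    ultimately show ?thesis using \<open>1 < p\<close> by (simp add: divide_le_cancel)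
  qed
  then show ?thesis
    using whp assms(3,4) by (subst nn_integral_eq_integral) (auto simp: s_def intro!: ennreal_leI)
qed simp

text \<open>This bump is of class \<open>C\<^sup>1\<close> with Lipschitz gradient, which is all that the test functions need, and
its derivatives can be estimated by hand. The scale \<open>e\<close> enters through the support, and every scale
is normalised by its own integral.\<close>

definition bump :: "real \<Rightarrow> 'a::euclidean_space \<Rightarrow> real" where
  "bump e x = (max 0 (e\<^sup>2 - x \<bullet> x))\<^sup>2"

definition bump_kernel :: "real \<Rightarrow> 'a::euclidean_space \<Rightarrow> real" where
  "bump_kernel e x = bump e x / (\<integral>y. bump e y \<partial>(lborel :: 'a measure))"

definition mollify :: "real \<Rightarrow> ('a::euclidean_space \<Rightarrow> 'b::euclidean_space) \<Rightarrow> 'a \<Rightarrow> 'b" where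
  "mollify e g x = (\<integral>y. bump_kernel e (x - y) *\<^sub>R g y \<partial>lborel)"

lemma continuous_bump: "continuous_on S (bump e)"
  unfolding bump_def by (intro continuous_intros)

lemma bump_nonneg: "0 \<le> bump e x" by (simp add: bump_def)

lemma bump_eq_0: "0 \<le> e \<Longrightarrow> e \<le> norm x \<Longrightarrow> bump e x = 0"
  by (simp add: bump_def dot_square_norm power_mono)

lemma bump_pos: "norm x < e \<Longrightarrow> 0 < bump e x"
  using power_strict_mono[of "norm x" e 2] by (simp add: bump_def dot_square_norm)

lemma measurable_bump[measurable]: "bump e \<in> borel_measurable borel"
  by (intro borel_measurable_continuous_onI continuous_bump)

lemma measurable_kernel[measurable]: "bump_kernel e \<in> borel_measurable borel"
  unfolding bump_kernel_def by measurable

lemma bump_le: "bump e x \<le> e ^ 4"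
proof -
  have "(max 0 (e\<^sup>2 - x \<bullet> x))\<^sup>2 \<le> (e\<^sup>2)\<^sup>2"
    by (intro power_mono) auto
  then show ?thesis by (simp add: bump_def power_mult[symmetric])
qed

lemma integrable_bump:
  assumes "0 < e" shows "integrable lborel (bump e :: 'a::euclidean_space \<Rightarrow> real)"
proof (rule Bochner_Integration.integrable_bound)
  show "integrable lborel (\<lambda>x::'a. e ^ 4 * indicat_real (cball 0 e) x)"
    by (intro integrable_mult_right integrable_real_indicator emeasure_lborel_cball_finite) simp
  show "AE x::'a in lborel. norm (bump e x) \<le> norm (e ^ 4 * indicat_real (cball 0 e) x)"
  proof (rule AE_I2)
    fix x :: 'a
    show "norm (bump e x) \<le> norm (e ^ 4 * indicat_real (cball 0 e) x)"
      using assms bump_eq_0[of e x] by (cases "norm x \<le> e") (auto simp: bump_le bump_nonneg)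
  qed
qed simp

lemma bump_mass_pos:
  assumes "0 < e" shows "0 < (\<integral>x. bump e x \<partial>(lborel :: 'a::euclidean_space measure))"
proof -
  have "\<not> (AE x in (lborel :: 'a measure). bump e x = 0)"
  proof
    assume "AE x in (lborel :: 'a measure). bump e x = 0"
    then have "AE x in (lborel :: 'a measure). x \<notin> ball 0 e"
      by eventually_elim (use bump_pos in fastforce)
    then have "emeasure lborel (ball (0::'a) e) = 0"
      by (subst (asm) AE_iff_measurable[of "ball 0 e"]) auto
    then show False
      using content_ball_pos[OF assms, of "0::'a"] by (simp add: measure_def)
  qed
  then have "(\<integral>x. bump e x \<partial>(lborel :: 'a measure)) \<noteq> 0"
    by (subst integral_nonneg_eq_0_iff_AE[OF integrable_bump[OF assms]]) (auto simp: bump_nonneg)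
  then show ?thesis
    by (simp add: bump_nonneg less_le)
qed

lemma
  fixes x y :: "'a::euclidean_space"
  assumes "0 < e"
  shows kernel_nonneg: "0 \<le> bump_kernel e x"
    and kernel_eq_0: "e \<le> norm x \<Longrightarrow> bump_kernel e x = 0"
    and kernel_le: "bump_kernel e x \<le> bump_kernel e (0::'a)"
    and kernel_minus: "bump_kernel e (x - y) = bump_kernel e (y - x)"
    and integrable_kernel: "integrable lborel (bump_kernel e :: 'a \<Rightarrow> real)"
    and integral_kernel: "(\<integral>z. bump_kernel e z \<partial>(lborel :: 'a measure)) = 1"
proof -
  note pos = bump_mass_pos[OF assms, where 'a='a]
  show "0 \<le> bump_kernel e x" using pos by (simp add: bump_kernel_def bump_nonneg)
  show "e \<le> norm x \<Longrightarrow> bump_kernel e x = 0" using assms by (simp add: bump_kernel_def bump_eq_0)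
  have "bump e x \<le> bump e (0::'a)"
    unfolding bump_def by (intro power_mono) auto
  then show "bump_kernel e x \<le> bump_kernel e (0::'a)" unfolding bump_kernel_def by (rule divide_right_mono) (use pos in simp)
  show "bump_kernel e (x - y) = bump_kernel e (y - x)"
    by (simp add: bump_kernel_def bump_def dot_square_norm norm_minus_commute)
  show "integrable lborel (bump_kernel e :: 'a \<Rightarrow> real)"
    unfolding bump_kernel_def by (intro integrable_divide integrable_bump assms)
  show "(\<integral>z. bump_kernel e z \<partial>(lborel :: 'a measure)) = 1"
    using pos by (simp add: bump_kernel_def)
qed

lemma integrable_kernel_scaleR:
  fixes g :: "'a::euclidean_space \<Rightarrow> 'b::euclidean_space"
  assumes "0 < e" "integrable lborel g"
  shows "integrable lborel (\<lambda>y. bump_kernel e (x - y) *\<^sub>R g y)" and "integrable lborel (\<lambda>z. bump_kernel e z *\<^sub>R g z)"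
proof -
  have [measurable]: "g \<in> borel_measurable borel" using assms(2) by auto
  show "integrable lborel (\<lambda>y. bump_kernel e (x - y) *\<^sub>R g y)"
    by (rule Bochner_Integration.integrable_bound[OF integrable_mult_right[OF integrable_norm[OF assms(2)], of "bump_kernel e (0::'a)"]])
       (auto intro!: AE_I2 mult_right_mono simp: abs_mult kernel_nonneg[OF assms(1)] kernel_le[OF assms(1)])
  show "integrable lborel (\<lambda>y. bump_kernel e y *\<^sub>R g y)"
    by (rule Bochner_Integration.integrable_bound[OF integrable_mult_right[OF integrable_norm[OF assms(2)], of "bump_kernel e (0::'a)"]])
       (auto intro!: AE_I2 mult_right_mono simp: abs_mult kernel_nonneg[OF assms(1)] kernel_le[OF assms(1)])
qed

text \<open>In this form a mollification is a mean of translates, to which Jensen's inequality applies.\<close>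

lemma mollify_eq:
  fixes g :: "'a::euclidean_space \<Rightarrow> 'b::euclidean_space"
  assumes "0 < e" and [measurable]: "g \<in> borel_measurable borel"
  shows "mollify e g x = (\<integral>z. bump_kernel e z *\<^sub>R g (z + x) \<partial>lborel)"
  unfolding mollify_def
  by (subst integral_lborel_translate[symmetric, where c = x])
     (auto simp: kernel_minus[OF assms(1), of 0, simplified])

lemma measurable_mollify[measurable]:
  fixes g :: "'a::euclidean_space \<Rightarrow> 'b::euclidean_space"
  assumes [measurable]: "g \<in> borel_measurable borel"
  shows "mollify e g \<in> borel_measurable borel"
proof -
  have "mollify e g \<in> borel_measurable lborel"
    unfolding mollify_def by measurable
  then show ?thesis by simp
qed

text \<open>The difference \<open>mollify e g - g\<close> is a mean of differences between translates of \<open>g\<close> and \<open>g\<close> itself,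
over translation vectors of length at most \<open>e\<close>. By Jensen's inequality and Fubini its \<open>L\<^sup>p\<close> norm is
at most that of the worst such difference.\<close>

lemma mollify_tendsto_Lp:
  fixes g :: "'a::euclidean_space \<Rightarrow> 'b::euclidean_space"
  assumes int: "integrable lborel g" and "1 \<le> p"
    and fin: "(\<integral>\<^sup>+x. ennreal (norm (g x) powr p) \<partial>lborel) < \<infinity>" and "0 < \<delta>"
  shows "\<exists>d>0. \<forall>e. 0 < e \<and> e \<le> d \<longrightarrow>
           (\<integral>\<^sup>+x. ennreal (norm (mollify e g x - g x) powr p) \<partial>lborel) \<le> ennreal \<delta>"
proof -
  have gm[measurable]: "g \<in> borel_measurable borel" using int by auto
  obtain d where d: "0 < d" "\<And>z. norm z \<le> d \<Longrightarrow>
      (\<integral>\<^sup>+x. ennreal (norm (g (x + z) - g x) powr p) \<partial>lborel) \<le> ennreal \<delta>"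
    using Lp_continuity_of_translation[OF gm \<open>1 \<le> p\<close> fin \<open>0 < \<delta>\<close>] by auto
  show ?thesis
  proof (intro exI[of _ d] conjI allI impI)
    fix e assume e: "0 < e \<and> e \<le> d"
    then have "0 < e" by simp
    let ?k = "bump_kernel e :: 'a \<Rightarrow> real"
    have pw: "ennreal (norm (mollify e g x - g x) powr p)
        \<le> (\<integral>\<^sup>+z. ennreal (?k z * norm (g (z + x) - g x) powr p) \<partial>lborel)" for x
    proof -
      have i1: "integrable lborel (\<lambda>z. ?k z *\<^sub>R g (z + x))"
        by (intro integrable_kernel_scaleR \<open>0 < e\<close> integrable_lborel_translate int)
      have i2: "integrable lborel (\<lambda>z. ?k z *\<^sub>R g x)"
        by (intro integrable_scaleR_left integrable_kernel \<open>0 < e\<close>)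
      have i: "integrable lborel (\<lambda>z. ?k z *\<^sub>R (g (z + x) - g x))"
        using Bochner_Integration.integrable_diff[OF i1 i2] by (simp add: scaleR_diff_right)
      have i': "integrable lborel (\<lambda>z. ?k z * norm (g (z + x) - g x))"
        using integrable_norm[OF i] kernel_nonneg[OF \<open>0 < e\<close>, where 'a='a] by simp
      have "mollify e g x - g x = (\<integral>z. ?k z *\<^sub>R g (z + x) \<partial>lborel) - (\<integral>z. ?k z *\<^sub>R g x \<partial>lborel)"
        using \<open>0 < e\<close> by (simp add: mollify_eq integral_kernel integrable_kernel)
      also have "\<dots> = (\<integral>z. ?k z *\<^sub>R (g (z + x) - g x) \<partial>lborel)"
        using i1 i2 by (simp add: scaleR_diff_right)
      finally have "norm (mollify e g x - g x) \<le> (\<integral>z. norm (?k z *\<^sub>R (g (z + x) - g x)) \<partial>lborel)"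
        by (simp only: integral_norm_bound)
      also have "\<dots> = (\<integral>z. ?k z * norm (g (z + x) - g x) \<partial>lborel)"
        using kernel_nonneg[OF \<open>0 < e\<close>, where 'a='a] by simp
      finally have "ennreal (norm (mollify e g x - g x) powr p) \<le> ennreal ((\<integral>z. ?k z * norm (g (z + x) - g x) \<partial>lborel) powr p)"
        using \<open>1 \<le> p\<close> by (intro ennreal_leI powr_mono2) auto
      also have "\<dots> \<le> (\<integral>\<^sup>+z. ennreal (?k z * norm (g (z + x) - g x) powr p) \<partial>lborel)"
        using \<open>0 < e\<close> i' \<open>1 \<le> p\<close>
        by (intro jensen_powr_nn_integral) (auto simp: kernel_nonneg integrable_kernel integral_kernel)
      finally show ?thesis .
    qed
    have "(\<integral>\<^sup>+x. ennreal (norm (mollify e g x - g x) powr p) \<partial>lborel)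
        \<le> (\<integral>\<^sup>+x. (\<integral>\<^sup>+z. ennreal (?k z * norm (g (z + x) - g x) powr p) \<partial>lborel) \<partial>lborel)"
      by (intro nn_integral_mono pw)
    also have "\<dots> = (\<integral>\<^sup>+z. (\<integral>\<^sup>+x. ennreal (?k z * norm (g (z + x) - g x) powr p) \<partial>lborel) \<partial>lborel)"
      by (rule lborel_pair.Fubini') measurable
    also have "\<dots> = (\<integral>\<^sup>+z. ennreal (?k z) * (\<integral>\<^sup>+x. ennreal (norm (g (x + z) - g x) powr p) \<partial>lborel) \<partial>lborel)"
      using \<open>0 < e\<close> by (intro nn_integral_cong) (simp add: ennreal_mult kernel_nonneg nn_integral_cmult add.commute)
    also have "\<dots> \<le> (\<integral>\<^sup>+z. ennreal (?k z) * ennreal \<delta> \<partial>lborel)"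
    proof (rule nn_integral_mono)
      fix z :: 'a
      show "ennreal (?k z) * (\<integral>\<^sup>+x. ennreal (norm (g (x + z) - g x) powr p) \<partial>lborel) \<le> ennreal (?k z) * ennreal \<delta>"
      proof (cases "norm z \<le> d")
        case True
        then show ?thesis by (intro mult_left_mono d) auto
      next
        case False
        then have "?k z = 0" using e by (intro kernel_eq_0) auto
        then show ?thesis by simp
      qed
    qed
    also have "\<dots> = ennreal (\<integral>z. ?k z \<partial>lborel) * ennreal \<delta>"
      using \<open>0 < e\<close> by (simp add: nn_integral_multc nn_integral_eq_integral integrable_kernel kernel_nonneg)
    finally show "(\<integral>\<^sup>+x. ennreal (norm (mollify e g x - g x) powr p) \<partial>lborel) \<le> ennreal \<delta>"
      using \<open>0 < e\<close> by (simp add: integral_kernel)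
  qed fact
qed

section \<open>Derivatives of mollified indicator functions\<close>

lemma square_pos_part_expansion:
  fixes s t :: real
  shows "\<bar>(max 0 (t + s))\<^sup>2 - (max 0 t)\<^sup>2 - 2 * max 0 t * s\<bar> \<le> s\<^sup>2"
proof -
  consider "0 \<le> t" "0 \<le> t + s" | "0 \<le> t" "t + s < 0" | "t < 0" "0 \<le> t + s" | "t < 0" "t + s < 0"
    by linarith
  then show ?thesis
  proof cases
    case 1
    then show ?thesis by (simp add: max_def power2_eq_square algebra_simps)
  next
    case 2
    have "t * (t + s) \<le> 0" "t * s \<le> 0" using 2 by (auto intro!: mult_nonneg_nonpos)
    moreover have "0 \<le> (t + s)\<^sup>2" by simp
    ultimately show ?thesis using 2 by (simp add: max_def power2_eq_square algebra_simps abs_le_iff)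
  next
    case 3
    then have "(t + s)\<^sup>2 \<le> s\<^sup>2" by (intro power_mono) auto
    then show ?thesis using 3 by (simp add: max_def)
  qed (simp add: max_def)
qed

lemma has_derivative_quadratic_remainder:
  fixes f :: "'a::real_normed_vector \<Rightarrow> 'b::real_normed_vector"
  assumes L: "bounded_linear L" and bound: "\<And>h. norm h \<le> 1 \<Longrightarrow> norm (f (x + h) - f x - L h) \<le> C * (norm h)\<^sup>2"
  shows "(f has_derivative L) (at x)"
proof -
  have "(\<lambda>h. norm (f (x + h) - f x - L h) / norm h) \<midarrow>0\<rightarrow> 0"
  proof (rule Lim_null_comparison)
    have "\<forall>\<^sub>F h in at (0::'a). h \<in> ball 0 1 \<and> h \<noteq> 0"
      by (auto simp: eventually_at intro!: exI[of _ "1::real"] simp: dist_norm)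
    then show "\<forall>\<^sub>F h in at 0. norm (norm (f (x + h) - f x - L h) / norm h) \<le> C * norm h"
    proof eventually_elim
      fix h :: 'a assume h: "h \<in> ball 0 1 \<and> h \<noteq> 0"
      then have "norm (f (x + h) - f x - L h) \<le> C * (norm h)\<^sup>2" by (intro bound) auto
      then show "norm (norm (f (x + h) - f x - L h) / norm h) \<le> C * norm h"
        using h by (simp add: pos_divide_le_eq power2_eq_square mult.assoc)
    qed
    show "((\<lambda>h. C * norm h) \<longlongrightarrow> 0) (at 0)"
      by (intro tendsto_mult_right_zero tendsto_norm_zero tendsto_ident_at)
  qed
  then show ?thesis using L by (simp add: has_derivative_at)
qed

definition kernel_grad :: "real \<Rightarrow> 'a::euclidean_space \<Rightarrow> 'a" where
  "kernel_grad e x = (- 4 * max 0 (e\<^sup>2 - x \<bullet> x) / (\<integral>y. bump e y \<partial>(lborel :: 'a measure))) *\<^sub>R x"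

lemma kernel_grad_eq_0: "0 < e \<Longrightarrow> e \<le> norm x \<Longrightarrow> kernel_grad e x = 0"
  using power_mono[of e "norm x" 2] by (simp add: kernel_grad_def dot_square_norm)

lemma continuous_kernel_grad: "continuous_on S (kernel_grad e)"
  unfolding kernel_grad_def divide_inverse by (intro continuous_intros)

lemma measurable_kernel_grad[measurable]: "kernel_grad e \<in> borel_measurable borel"
  by (intro borel_measurable_continuous_onI continuous_kernel_grad)

lemma kernel_grad_bounded:
  assumes "0 < e"
  shows "\<exists>C\<ge>0. \<forall>x::'a::euclidean_space. norm (kernel_grad e x) \<le> C"
proof -
  have "bounded (kernel_grad e ` cball (0::'a) e)"
    by (intro compact_imp_bounded compact_continuous_image continuous_kernel_grad) simp
  then obtain C where C: "\<forall>x\<in>cball (0::'a) e. norm (kernel_grad e x) \<le> C"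
    unfolding bounded_iff by auto
  have "norm (kernel_grad e x) \<le> max 0 C" for x :: 'a
    using C kernel_grad_eq_0[OF assms, of x] by (cases "norm x \<le> e") (auto intro: max.coboundedI2)
  then show ?thesis by (intro exI[of _ "max 0 C"]) auto
qed

text \<open>A remainder that is quadratic in \<open>h\<close>, uniformly for \<open>x\<close> in a bounded set, can be integrated in \<open>x\<close>;
this is how differentiation passes under the integral sign in
\<open>has_derivative_mollified_indicator\<close>.\<close>

lemma kernel_quadratic_remainder:
  assumes "0 < e"
  shows "\<exists>C\<ge>0. \<forall>x h :: 'a::euclidean_space. norm x \<le> R \<longrightarrow> norm h \<le> 1 \<longrightarrow>
     \<bar>bump_kernel e (x + h) - bump_kernel e x - kernel_grad e x \<bullet> h\<bar> \<le> C * (norm h)\<^sup>2"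
proof -
  define m where "m = (\<integral>y. bump e y \<partial>(lborel :: 'a measure))"
  have "0 < m" unfolding m_def by (rule bump_mass_pos[OF assms])
  define C where "C = ((2 * \<bar>R\<bar> + 1)\<^sup>2 + 2 * e\<^sup>2) / m"
  have "\<bar>bump_kernel e (x + h) - bump_kernel e x - kernel_grad e x \<bullet> h\<bar> \<le> C * (norm h)\<^sup>2"
    if x: "norm x \<le> R" and h: "norm h \<le> 1" for x h :: 'a
  proof -
    \<comment> \<open>The kernel is \<open>(max 0 t)\<^sup>2 / m\<close>, and \<open>s\<close> is the increment of \<open>t\<close> from \<open>x\<close> to \<open>x + h\<close>.\<close>
    define t s where "t = e\<^sup>2 - x \<bullet> x" and "s = - 2 * (x \<bullet> h) - h \<bullet> h"
    have ts: "e\<^sup>2 - (x + h) \<bullet> (x + h) = t + s"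
      by (simp add: t_def s_def inner_add_left inner_add_right inner_commute)
    have "bump_kernel e (x + h) - bump_kernel e x - kernel_grad e x \<bullet> h =
      ((max 0 (t + s))\<^sup>2 - (max 0 t)\<^sup>2 - 2 * max 0 t * s - 2 * max 0 t * (h \<bullet> h)) / m"
      unfolding bump_kernel_def kernel_grad_def m_def[symmetric] unfolding bump_def ts t_def[symmetric]
      using \<open>0 < m\<close> by (simp add: s_def field_simps)
    also have "\<bar>\<dots>\<bar> \<le> (s\<^sup>2 + 2 * e\<^sup>2 * (norm h)\<^sup>2) / m"
    proof -
      have "0 \<le> max 0 t" "max 0 t \<le> e\<^sup>2" by (auto simp: t_def)
      then have "\<bar>2 * max 0 t * (h \<bullet> h)\<bar> \<le> 2 * e\<^sup>2 * (norm h)\<^sup>2"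
        by (simp add: dot_square_norm abs_mult mult_right_mono)
      then have "\<bar>(max 0 (t + s))\<^sup>2 - (max 0 t)\<^sup>2 - 2 * max 0 t * s - 2 * max 0 t * (h \<bullet> h)\<bar> \<le> s\<^sup>2 + 2 * e\<^sup>2 * (norm h)\<^sup>2"
        using square_pos_part_expansion[of t s] by linarith
      then show ?thesis
        using \<open>0 < m\<close> by (simp add: abs_divide divide_right_mono)
    qed
    also have "s\<^sup>2 \<le> ((2 * \<bar>R\<bar> + 1) * norm h)\<^sup>2"
    proof (rule power2_le_iff_abs_le[THEN iffD2])
      have "\<bar>s\<bar> \<le> 2 * \<bar>x \<bullet> h\<bar> + (norm h)\<^sup>2"
        using inner_ge_zero[of h] unfolding s_def dot_square_norm[symmetric] by linarith
      also have "\<bar>x \<bullet> h\<bar> \<le> \<bar>R\<bar> * norm h"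
        using Cauchy_Schwarz_ineq2[of x h] x by (smt (verit) mult_right_mono norm_ge_zero)
      also have "(norm h)\<^sup>2 \<le> 1 * norm h" using h by (simp add: power2_eq_square mult_left_le)
      finally show "\<bar>s\<bar> \<le> (2 * \<bar>R\<bar> + 1) * norm h" by (simp add: algebra_simps)
    qed simp
    also have "(((2 * \<bar>R\<bar> + 1) * norm h)\<^sup>2 + 2 * e\<^sup>2 * (norm h)\<^sup>2) / m = C * (norm h)\<^sup>2"
      unfolding C_def power_mult_distrib by (simp only: add_divide_distrib distrib_right times_divide_eq_left)
    finally show ?thesis using \<open>0 < m\<close> by (simp add: divide_right_mono)
  qed
  moreover have "0 \<le> C" using \<open>0 < m\<close> by (simp add: C_def)
  ultimately show ?thesis by blast
qed

lemma has_derivative_kernel: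
  assumes "0 < e"
  shows "(bump_kernel e has_derivative (\<lambda>h. kernel_grad e x \<bullet> h)) (at x)"
proof -
  obtain C where "\<And>h. norm h \<le> 1 \<Longrightarrow>
     \<bar>bump_kernel e (x + h) - bump_kernel e x - kernel_grad e x \<bullet> h\<bar> \<le> C * (norm h)\<^sup>2"
    using kernel_quadratic_remainder[OF assms, where R = "norm x" and 'a='a] by blast
  then show ?thesis
    by (intro has_derivative_quadratic_remainder[where C = C]) (auto intro: bounded_linear_inner_right)
qed

lemma partial_deriv_eqI:
  "(f has_derivative D) (at x) \<Longrightarrow> partial_deriv j f x = D (axis j 1)"
  by (simp add: partial_deriv_def frechet_derivative_at[symmetric])

definition mollified_indicator_grad :: "real \<Rightarrow> 'a::euclidean_space set \<Rightarrow> 'a \<Rightarrow> 'a" where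
  "mollified_indicator_grad e U x = (\<integral>y. indicat_real U y *\<^sub>R kernel_grad e (x - y) \<partial>lborel)"

lemma integrable_indicator_bounded:
  fixes f :: "'a::euclidean_space \<Rightarrow> 'b::{banach, second_countable_topology}"
  assumes "bounded U" and [measurable]: "U \<in> sets borel" and [measurable]: "f \<in> borel_measurable borel" and "\<And>y. norm (f y) \<le> C"
  shows "integrable lborel (\<lambda>y. indicat_real U y *\<^sub>R f y)"
proof (rule Bochner_Integration.integrable_bound)
  show "integrable lborel (\<lambda>y. C * indicat_real U y)"
    using emeasure_bounded_finite[OF assms(1)] assms(2)
    by (intro integrable_mult_right integrable_real_indicator) auto
  show "AE y in lborel. norm (indicat_real U y *\<^sub>R f y) \<le> norm (C * indicat_real U y)"
    using assms(4) by (intro AE_I2) (auto simp: indicator_def intro: order_trans[OF _ abs_ge_self])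
qed simp

lemma has_derivative_mollified_indicator:
  fixes U :: "'a::euclidean_space set"
  assumes "0 < e" and U: "bounded U" and Ub[measurable]: "U \<in> sets borel"
  shows "(mollify e (indicat_real U) has_derivative (\<lambda>h. mollified_indicator_grad e U x \<bullet> h)) (at x)"
proof -
  obtain r where r: "\<And>y. y \<in> U \<Longrightarrow> norm y \<le> r" using U by (auto simp: bounded_iff)
  obtain C where C: "0 \<le> C" "\<And>z h :: 'a. norm z \<le> norm x + r \<Longrightarrow> norm h \<le> 1 \<Longrightarrow>
     \<bar>bump_kernel e (z + h) - bump_kernel e z - kernel_grad e z \<bullet> h\<bar> \<le> C * (norm h)\<^sup>2"
    using kernel_quadratic_remainder[OF \<open>0 < e\<close>, where R = "norm x + r" and 'a='a] by blast
  obtain D where D: "\<And>z::'a. norm (kernel_grad e z) \<le> D" using kernel_grad_bounded[OF \<open>0 < e\<close>, where 'a='a] by blast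
  have ig: "integrable lborel (\<lambda>y. indicat_real U y *\<^sub>R kernel_grad e (x - y))"
    using D by (intro integrable_indicator_bounded U Ub) auto
  have ik: "integrable lborel (\<lambda>y. indicat_real U y *\<^sub>R bump_kernel e (z - y))" for z
    using kernel_nonneg[OF \<open>0 < e\<close>, where 'a='a] kernel_le[OF \<open>0 < e\<close>, where 'a='a]
    by (intro integrable_indicator_bounded[where C = "bump_kernel e (0::'a)"] U Ub) auto
  have iU: "integrable lborel (indicat_real U)"
    using emeasure_bounded_finite[OF U] by (intro integrable_real_indicator) auto
  have mollify: "mollify e (indicat_real U) z = (\<integral>y. indicat_real U y *\<^sub>R bump_kernel e (z - y) \<partial>lborel)" for z
    by (simp add: mollify_def mult.commute)
  show ?thesis
  proof (rule has_derivative_quadratic_remainder[where C = "C * measure lborel U"])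
    fix h :: 'a assume h: "norm h \<le> 1"
    have "mollify e (indicat_real U) (x + h) - mollify e (indicat_real U) x - mollified_indicator_grad e U x \<bullet> h
      = (\<integral>y. indicat_real U y *\<^sub>R (bump_kernel e (x + h - y) - bump_kernel e (x - y) - kernel_grad e (x - y) \<bullet> h) \<partial>lborel)"
      unfolding mollify mollified_indicator_grad_def using ik[of x] ik[of "x + h"] ig integrable_inner_left[OF ig, of h]
      by (simp add: integral_inner_left[OF ig, symmetric] right_diff_distrib del: integral_inner_left)
    also have "norm \<dots> \<le> (\<integral>y. indicat_real U y * (C * (norm h)\<^sup>2) \<partial>lborel)"
    proof (rule order_trans[OF integral_norm_bound integral_mono])
      show "integrable lborel (\<lambda>y. norm (indicat_real U y *\<^sub>R (bump_kernel e (x + h - y) - bump_kernel e (x - y) - kernel_grad e (x - y) \<bullet> h)))"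
        using integrable_norm[OF Bochner_Integration.integrable_diff[OF Bochner_Integration.integrable_diff[OF ik[of "x + h"] ik[of x]] integrable_inner_left[OF ig, of h]]]
        by (simp add: right_diff_distrib del: integrable_norm_iff)
      show "norm (indicat_real U y *\<^sub>R (bump_kernel e (x + h - y) - bump_kernel e (x - y) - kernel_grad e (x - y) \<bullet> h))
          \<le> indicat_real U y * (C * (norm h)\<^sup>2)" for y
      proof (cases "y \<in> U")
        case True
        then have "norm (x - y) \<le> norm x + r"
          using norm_triangle_ineq4[of x y] r[OF True] by linarith
        from C(2)[OF this h] True show ?thesis by (simp add: algebra_simps)
      qed simp
    qed (use iU in simp)
    finally show "norm (mollify e (indicat_real U) (x + h) - mollify e (indicat_real U) x - mollified_indicator_grad e U x \<bullet> h)
      \<le> C * measure lborel U * (norm h)\<^sup>2"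
      by (simp add: algebra_simps)
  qed (rule bounded_linear_inner_right)
qed

lemma continuous_mollified_indicator_grad:
  fixes U :: "'a::euclidean_space set"
  assumes "0 < e" and U: "bounded U" and Ub[measurable]: "U \<in> sets borel"
  shows "continuous_on S (mollified_indicator_grad e U)"
proof (rule continuous_on_subset[OF _ subset_UNIV], unfold continuous_on_sequentially, intro ballI allI impI, unfold comp_def)
  fix x :: 'a and X assume X: "(\<forall>n. X n \<in> UNIV) \<and> X \<longlonglongrightarrow> x"
  obtain D where D: "\<And>z::'a. norm (kernel_grad e z) \<le> D" using kernel_grad_bounded[OF \<open>0 < e\<close>, where 'a='a] by blast
  show "(\<lambda>n. mollified_indicator_grad e U (X n)) \<longlonglongrightarrow> mollified_indicator_grad e U x"
    unfolding mollified_indicator_grad_def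
  proof (rule integral_dominated_convergence[where w = "\<lambda>y. D * indicat_real U y"])
    show "integrable lborel (\<lambda>y. D * indicat_real U y)"
      using emeasure_bounded_finite[OF U] by (intro integrable_mult_right integrable_real_indicator) auto
    show "AE y in lborel. (\<lambda>n. indicat_real U y *\<^sub>R kernel_grad e (X n - y)) \<longlonglongrightarrow> indicat_real U y *\<^sub>R kernel_grad e (x - y)"
      using X
      by (intro AE_I2 tendsto_intros continuous_on_tendsto_compose[OF continuous_kernel_grad[of UNIV e]]) auto
    show "AE y in lborel. norm (indicat_real U y *\<^sub>R kernel_grad e (X n - y)) \<le> D * indicat_real U y" for n
      using D by (intro AE_I2) (auto simp: indicator_def)
  qed auto
qed

text \<open>Fubini's theorem is applied to Borel functions and \<open>lborel\<close>; this lemma and its almost everywhere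
version \<open>integral_lebesgue_on_eq_AE\<close> translate the integrals over \<open>lebesgue_on\<close>.\<close>

lemma integral_lebesgue_on_eq:
  fixes f :: "'a::euclidean_space \<Rightarrow> 'b::{banach, second_countable_topology}"
  assumes [measurable]: "S \<in> sets borel" "(\<lambda>x. indicat_real S x *\<^sub>R f x) \<in> borel_measurable borel"
  shows "(\<integral>x. f x \<partial>lebesgue_on S) = (\<integral>x. indicat_real S x *\<^sub>R f x \<partial>lborel)"
  using assms by (subst integral_restrict_space) (auto intro!: integral_completion)

section \<open>The weak equation tested with a mollified indicator function\<close>

lemma green_domain_formula:
  fixes \<phi> :: "real^'n::finite \<Rightarrow> real"
  assumes green: "green_domain U \<sigma> \<nu>" and "C_k_on 1 \<phi> UNIV"
  shows "(\<integral>x. partial_deriv j \<phi> x \<partial>lebesgue_on U) = (\<integral>x. \<nu> x $ j * \<phi> x \<partial>\<sigma>)"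
proof -
  note all = green[unfolded green_domain_def, THEN conjunct2, THEN conjunct2, THEN conjunct2, THEN conjunct2,
      THEN conjunct2, THEN conjunct2, THEN conjunct2]
  show ?thesis
    by (rule all[THEN spec, THEN mp, THEN spec], rule exI[of _ UNIV]) (use assms(2) in blast)
qed

text \<open>Green's formula for the test function \<open>y \<mapsto> bump_kernel e (x - y)\<close>. Its derivative with respect to
\<open>y\<close> is minus the derivative of the kernel, whence the sign.\<close>

lemma green_domain_kernel:
  fixes U :: "(real^'n::finite) set"
  assumes green: "green_domain U \<sigma> \<nu>" and "0 < e"
  shows "mollified_indicator_grad e U x $ j = - (\<integral>y. \<nu> y $ j * bump_kernel e (x - y) \<partial>\<sigma>)"
proof -
  define \<psi> where "\<psi> y = bump_kernel e (x - y)" for y :: "real^'n"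
  have U: "bounded U" "open U" using green by (auto simp: green_domain_def)
  then have [measurable]: "U \<in> sets borel" by simp
  have d: "(\<psi> has_derivative (\<lambda>h. - (kernel_grad e (x - y) \<bullet> h))) (at y)" for y
  proof -
    have "((\<lambda>y. bump_kernel e (x - y)) has_derivative (\<lambda>h. kernel_grad e (x - y) \<bullet> (0 - h))) (at y)"
      by (rule has_derivative_compose[OF _ has_derivative_kernel[OF \<open>0 < e\<close>]])
         (intro has_derivative_diff has_derivative_const has_derivative_ident)
    then show ?thesis by (simp add: \<psi>_def[abs_def])
  qed
  have pd: "partial_deriv i \<psi> y = - (kernel_grad e (x - y) $ i)" for i y
    by (simp add: partial_deriv_eqI[OF d] inner_axis)
  have c: "continuous_on UNIV (\<lambda>y. kernel_grad e (x - y))"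
    by (rule continuous_on_compose2[OF continuous_kernel_grad[of UNIV e]])
       (auto intro!: continuous_on_diff continuous_on_const continuous_on_id)
  have "C_k_on 1 \<psi> UNIV"
    unfolding One_nat_def C_k_on.simps pd[abs_def]
  proof (intro conjI ballI allI)
    show "\<psi> differentiable at y" for y using d[of y] by (rule differentiableI)
    show "continuous_on UNIV (\<lambda>y. - (kernel_grad e (x - y) $ i))" for i
      by (intro continuous_on_minus continuous_on_component c)
  qed
  then have "(\<integral>y. partial_deriv j \<psi> y \<partial>lebesgue_on U) = (\<integral>y. \<nu> y $ j * \<psi> y \<partial>\<sigma>)"
    by (rule green_domain_formula[OF green])
  moreover have "(\<integral>y. partial_deriv j \<psi> y \<partial>lebesgue_on U) = - (mollified_indicator_grad e U x $ j)"
  proof -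
    obtain D where D: "\<And>z::real^'n. norm (kernel_grad e z) \<le> D" using kernel_grad_bounded[OF \<open>0 < e\<close>, where 'a="real^'n"] by blast
    have ig: "integrable lborel (\<lambda>y. indicat_real U y *\<^sub>R kernel_grad e (x - y))"
      using D U by (intro integrable_indicator_bounded) auto
    have "(\<integral>y. partial_deriv j \<psi> y \<partial>lebesgue_on U) = (\<integral>y. indicat_real U y *\<^sub>R (- (kernel_grad e (x - y) $ j)) \<partial>lborel)"
      unfolding pd
      by (intro integral_lebesgue_on_eq borel_measurable_scaleR borel_measurable_uminus
          borel_measurable_continuous_onI[OF continuous_on_component[OF c]]) measurable
    also have "\<dots> = - (\<integral>y. (indicat_real U y *\<^sub>R kernel_grad e (x - y)) \<bullet> axis j 1 \<partial>lborel)"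
      by (simp add: inner_axis)
    also have "\<dots> = - (mollified_indicator_grad e U x $ j)"
      by (subst integral_inner_left) (auto simp: ig mollified_indicator_grad_def inner_axis)
    finally show ?thesis .
  qed
  ultimately show ?thesis by (simp add: \<psi>_def)
qed

text \<open>Because the kernel is even, mollification may be moved from a measure to a function. The lemma is
used for the surface measure with \<open>w = \<nu>\<^sub>j\<close> and for Lebesgue measure on \<open>U\<close> with \<open>w = 1\<close>.\<close>

lemma mollify_Fubini:
  fixes b :: "'a::euclidean_space \<Rightarrow> real" and w :: "'a \<Rightarrow> real"
  assumes "finite_measure M" and id: "(\<lambda>y. y) \<in> measurable M borel" and w: "integrable M w"
    and b: "integrable lborel b" and "0 < e"
  shows "(\<integral>x. b x * (\<integral>y. w y * bump_kernel e (x - y) \<partial>M) \<partial>lborel) = (\<integral>y. w y * mollify e b y \<partial>M)"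
proof -
  have sfM: "sigma_finite_measure M" using assms(1) by (simp add: finite_measure_def)
  interpret finite_measure M by fact
  interpret pair_sigma_finite lborel M ..
  have [measurable]: "w \<in> borel_measurable M" "b \<in> borel_measurable borel" using w b by auto
  have snd: "snd \<in> measurable ((lborel :: 'a measure) \<Otimes>\<^sub>M M) borel"
    by (rule measurable_compose[OF measurable_snd id])
  have [measurable]: "(\<lambda>z. bump_kernel e (fst z - snd z)) \<in> borel_measurable ((lborel :: 'a measure) \<Otimes>\<^sub>M M)"
    by (intro measurable_compose[OF _ measurable_kernel] borel_measurable_diff snd)
       (use measurable_fst[of "lborel :: 'a measure" M] in simp)
  let ?f = "\<lambda>x y. b x * (w y * bump_kernel e (x - y))"
  have meas[measurable]: "(\<lambda>z. ?f (fst z) (snd z)) \<in> borel_measurable (lborel \<Otimes>\<^sub>M M)"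
    by measurable
  have bound: "norm (?f x y) \<le> \<bar>b x\<bar> * (bump_kernel e (0::'a) * \<bar>w y\<bar>)" for x y
    using kernel_nonneg[OF \<open>0 < e\<close>, of "x - y"] kernel_le[OF \<open>0 < e\<close>, of "x - y"]
    by (auto simp: abs_mult mult.commute intro!: mult_left_mono)
  have "integrable (lborel \<Otimes>\<^sub>M M) (\<lambda>(x, y). ?f x y)"
  proof (rule integrableI_bounded)
    show "(\<lambda>(x, y). ?f x y) \<in> borel_measurable (lborel \<Otimes>\<^sub>M M)"
      using meas by (simp add: case_prod_beta')
    have "(\<integral>\<^sup>+z. ennreal (norm (case z of (x, y) \<Rightarrow> ?f x y)) \<partial>(lborel \<Otimes>\<^sub>M M))
      = (\<integral>\<^sup>+x. \<integral>\<^sup>+y. ennreal (norm (?f x y)) \<partial>M \<partial>lborel)"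
      using meas by (subst sigma_finite_measure.nn_integral_fst[OF sfM, symmetric]) (auto simp: case_prod_beta')
    also have "\<dots> \<le> (\<integral>\<^sup>+x. \<integral>\<^sup>+y. ennreal \<bar>b x\<bar> * (ennreal (bump_kernel e (0::'a)) * ennreal \<bar>w y\<bar>) \<partial>M \<partial>lborel)"
      using bound kernel_nonneg[OF \<open>0 < e\<close>, of "0::'a"]
      by (intro nn_integral_mono) (auto simp: ennreal_mult[symmetric] intro!: ennreal_leI)
    also have "\<dots> = (\<integral>\<^sup>+x. ennreal \<bar>b x\<bar> \<partial>lborel) * (ennreal (bump_kernel e (0::'a)) * (\<integral>\<^sup>+y. ennreal \<bar>w y\<bar> \<partial>M))"
      by (simp add: nn_integral_cmult nn_integral_multc)
    also have "\<dots> < \<infinity>"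
      using w b by (auto simp: integrable_iff_bounded ennreal_mult_less_top)
    finally show "(\<integral>\<^sup>+z. ennreal (norm (case z of (x, y) \<Rightarrow> ?f x y)) \<partial>(lborel \<Otimes>\<^sub>M M)) < \<infinity>" .
  qed
  from Fubini_integral[OF this]
  have "(\<integral>x. (\<integral>y. ?f x y \<partial>M) \<partial>lborel) = (\<integral>y. (\<integral>x. ?f x y \<partial>lborel) \<partial>M)" by simp
  moreover have "(\<integral>x. ?f x y \<partial>lborel) = w y * mollify e b y" for y
  proof -
    have "?f x y = w y * (bump_kernel e (y - x) * b x)" for x
      by (simp add: kernel_minus[OF \<open>0 < e\<close>, of x y])
    then have "(\<integral>x. ?f x y \<partial>lborel) = (\<integral>x. w y * (bump_kernel e (y - x) * b x) \<partial>lborel)"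
      by (simp only:)
    then show ?thesis by (simp add: mollify_def)
  qed
  ultimately show ?thesis by (simp only: integral_mult_right_zero)
qed

lemma bounded_linear_mollify:
  fixes g :: "'a::euclidean_space \<Rightarrow> 'b::euclidean_space" and T :: "'b \<Rightarrow> 'c::euclidean_space"
  assumes "bounded_linear T" "0 < e" "integrable lborel g"
  shows "T (mollify e g x) = mollify e (\<lambda>y. T (g y)) x"
proof -
  interpret T: bounded_linear T by fact
  show ?thesis
    unfolding mollify_def
    by (subst integral_bounded_linear[OF assms(1) integrable_kernel_scaleR(1)[OF assms(2,3)], symmetric])
       (simp add: T.scaleR)
qed

lemma inner_blinfun_adjoint:
  fixes L :: "'e::euclidean_space \<Rightarrow>\<^sub>L 'f::euclidean_space"
  shows "x \<bullet> blinfun_adjoint L y = L x \<bullet> y"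
proof -
  have lin: "linear (blinfun_apply L)"
    by (simp add: bounded_linear.linear blinfun.bounded_linear_right)
  then have "blinfun_apply (blinfun_adjoint L) = adjoint (blinfun_apply L)"
    unfolding blinfun_adjoint_def
    by (intro bounded_linear_Blinfun_apply) (simp add: adjoint_linear linear_conv_bounded_linear[symmetric])
  then show ?thesis by (simp add: adjoint_works[OF lin])
qed

lemma bounded_linear_blinfun_adjoint:
  "bounded_linear (blinfun_adjoint :: ('e::euclidean_space \<Rightarrow>\<^sub>L 'f::euclidean_space) \<Rightarrow> _)"
proof (rule bounded_linear_intro[where K = 1])
  fix L M :: "'e \<Rightarrow>\<^sub>L 'f" and r :: real
  show "blinfun_adjoint (L + M) = blinfun_adjoint L + blinfun_adjoint M"
    by (rule blinfun_eqI, rule vector_eq_ldot[THEN iffD1], rule allI)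
       (simp add: inner_blinfun_adjoint blinfun.add_left inner_add_left inner_add_right)
  show "blinfun_adjoint (r *\<^sub>R L) = r *\<^sub>R blinfun_adjoint L"
    by (rule blinfun_eqI, rule vector_eq_ldot[THEN iffD1], rule allI)
       (simp add: inner_blinfun_adjoint blinfun.scaleR_left)
  have "norm (blinfun_adjoint L) \<le> norm L"
  proof (rule norm_blinfun_bound)
    fix y
    let ?a = "blinfun_adjoint L y"
    have "norm ?a * norm ?a = L ?a \<bullet> y"
      by (simp add: inner_blinfun_adjoint[symmetric] dot_square_norm power2_eq_square)
    also have "\<dots> \<le> norm (L ?a) * norm y" by (rule norm_cauchy_schwarz)
    also have "\<dots> \<le> (norm L * norm ?a) * norm y" by (intro mult_right_mono norm_blinfun) simp
    finally have "norm ?a * norm ?a \<le> norm ?a * (norm L * norm y)" by (simp add: algebra_simps)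
    then show "norm ?a \<le> norm L * norm y"
      by (cases "norm ?a = 0") (simp, metis mult_left_le_imp_le norm_ge_zero order_le_less)
  qed simp
  then show "norm (blinfun_adjoint L) \<le> norm L * 1" by simp
qed

lemma partial_deriv_bounded_linear:
  assumes "bounded_linear T" "f differentiable (at x)"
  shows "partial_deriv j (\<lambda>y. T (f y)) x = T (partial_deriv j f x)"
proof -
  have "(f has_derivative frechet_derivative f (at x)) (at x)"
    using assms(2) by (simp add: frechet_derivative_works)
  from bounded_linear.has_derivative[OF assms(1) this] show ?thesis
    by (subst partial_deriv_eqI) (auto simp: partial_deriv_def)
qed

text \<open>In a test function \<open>\<Phi> f\<close> with constant \<open>f\<close> only the scalar factor is differentiated, and the
derivatives of the coefficients in the formal adjoint combine to the divergence of the symbol.\<close>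

lemma inner_formal_adjoint:
  assumes \<Phi>: "(\<Phi> has_derivative (\<lambda>h. d \<bullet> h)) (at x)" and A: "\<And>j. A j differentiable (at x)"
  shows "w \<bullet> formal_adjoint A B (\<lambda>y. \<Phi> y *\<^sub>R f) x
    = \<Phi> x * ((B x - div_symbol A x) w \<bullet> f) - (\<Sum>j\<in>UNIV. d $ j * (A j x w \<bullet> f))"
proof -
  interpret adj: bounded_linear blinfun_adjoint by (rule bounded_linear_blinfun_adjoint)
  have "((\<lambda>y. \<Phi> y *\<^sub>R f) has_derivative (\<lambda>h. (d \<bullet> h) *\<^sub>R f)) (at x)"
    by (intro derivative_intros \<Phi>)
  then have "partial_deriv j (\<lambda>y. \<Phi> y *\<^sub>R f) x = (d $ j) *\<^sub>R f" for j
    by (simp add: partial_deriv_eqI inner_axis)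
  moreover have "(\<Sum>j\<in>UNIV. partial_deriv j (\<lambda>y. blinfun_adjoint (A j y)) x) = blinfun_adjoint (div_symbol A x)"
    by (simp add: div_symbol_def adj.sum partial_deriv_bounded_linear[OF bounded_linear_blinfun_adjoint A])
  ultimately show ?thesis
    by (simp add: formal_adjoint_def adj.diff[symmetric] blinfun.scaleR_right inner_add_right inner_minus_right inner_diff_right
        inner_sum_right inner_blinfun_adjoint)
qed

lemma smooth_on_imp:
  assumes "smooth_on f S"
  shows smooth_on_continuous: "continuous_on S f"
    and smooth_on_differentiable: "x \<in> S \<Longrightarrow> f differentiable (at x)"
    and smooth_on_partial_deriv_continuous: "continuous_on S (partial_deriv j f)"
proof -
  have "C_k_on 0 f S" "C_k_on (Suc 0) f S" using assms unfolding smooth_on_def by blast+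
  then show "continuous_on S f" "x \<in> S \<Longrightarrow> f differentiable (at x)" "continuous_on S (partial_deriv j f)"
    by auto
qed

lemma continuous_on_div_symbol:
  assumes "\<And>j. smooth_on (A j) S"
  shows "continuous_on S (div_symbol A)"
  unfolding div_symbol_def
  by (intro continuous_on_sum smooth_on_partial_deriv_continuous assms)

lemma measurable_indicator_blinfun_apply:
  fixes L :: "'a::euclidean_space \<Rightarrow> 'e::euclidean_space \<Rightarrow>\<^sub>L 'f::euclidean_space"
  assumes L: "continuous_on K L" and K: "compact K" and [measurable]: "v \<in> borel_measurable borel"
  shows "(\<lambda>x. indicat_real K x *\<^sub>R L x (v x)) \<in> borel_measurable borel"
proof -
  have "(\<lambda>x. indicat_real K x *\<^sub>R L x b) \<in> borel_measurable borel" for b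
    using K by (intro borel_measurable_continuous_on_indicator continuous_intros L) (auto intro: borel_compact)
  then have "(\<lambda>x. \<Sum>b\<in>Basis. (v x \<bullet> b) *\<^sub>R (indicat_real K x *\<^sub>R L x b)) \<in> borel_measurable borel"
    by measurable
  moreover have "(\<lambda>x. \<Sum>b\<in>Basis. (v x \<bullet> b) *\<^sub>R (indicat_real K x *\<^sub>R L x b)) = (\<lambda>x. indicat_real K x *\<^sub>R L x (v x))"
  proof
    fix x
    have "L x (v x) = L x (\<Sum>b\<in>Basis. (v x \<bullet> b) *\<^sub>R b)" by (simp add: euclidean_representation)
    also have "\<dots> = (\<Sum>b\<in>Basis. (v x \<bullet> b) *\<^sub>R L x b)" by (simp add: blinfun.sum_right blinfun.scaleR_right)
    finally show "(\<Sum>b\<in>Basis. (v x \<bullet> b) *\<^sub>R (indicat_real K x *\<^sub>R L x b)) = indicat_real K x *\<^sub>R L x (v x)"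
      by (simp add: scaleR_sum_right mult.commute)
  qed
  ultimately show ?thesis by simp
qed

lemma compact_blinfun_bound:
  fixes L :: "'a::euclidean_space \<Rightarrow> 'e::euclidean_space \<Rightarrow>\<^sub>L 'f::euclidean_space"
  assumes "continuous_on K L" "compact K"
  shows "\<exists>C\<ge>0. \<forall>x\<in>K. \<forall>w. norm (L x w) \<le> C * norm w"
proof -
  have "bounded (L ` K)" using assms by (intro compact_imp_bounded compact_continuous_image)
  then obtain C where C: "\<forall>x\<in>K. norm (L x) \<le> C" by (auto simp: bounded_iff)
  have "norm (L x w) \<le> max 0 C * norm w" if "x \<in> K" for x w
    by (rule order_trans[OF norm_blinfun mult_right_mono]) (use C that in \<open>auto intro: max.coboundedI2\<close>)
  then show ?thesis by (intro exI[of _ "max 0 C"]) auto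
qed

lemma integrable_indicator_blinfun_apply:
  fixes L :: "'a::euclidean_space \<Rightarrow> 'e::euclidean_space \<Rightarrow>\<^sub>L 'f::euclidean_space"
  assumes L: "continuous_on K L" and K: "compact K" and v: "v \<in> borel_measurable borel"
    and int: "integrable lborel (\<lambda>x. indicat_real K x *\<^sub>R v x)"
  shows "integrable lborel (\<lambda>x. indicat_real K x *\<^sub>R L x (v x))"
proof -
  obtain C where C: "0 \<le> C" "\<forall>x\<in>K. \<forall>w. norm (L x w) \<le> C * norm w" using compact_blinfun_bound[OF L K] by auto
  show ?thesis
  proof (rule Bochner_Integration.integrable_bound[OF integrable_mult_right[OF integrable_norm[OF int], of C]])
    show "(\<lambda>x. indicat_real K x *\<^sub>R L x (v x)) \<in> borel_measurable lborel"
      using measurable_indicator_blinfun_apply[OF L K v] by simp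
  qed (use C in \<open>auto simp: indicator_def\<close>)
qed

lemma integral_lebesgue_on_eq_AE:
  fixes f h :: "'a::euclidean_space \<Rightarrow> 'b::euclidean_space"
  assumes [measurable]: "S \<in> sets borel" "h \<in> borel_measurable borel" and ae: "AE x in lebesgue_on S. f x = h x"
  shows "(\<integral>x. f x \<partial>lebesgue_on S) = (\<integral>x. indicat_real S x *\<^sub>R h x \<partial>lborel)"
proof -
  have ae': "AE x in lebesgue. indicat_real S x *\<^sub>R h x = indicat_real S x *\<^sub>R f x"
    using ae by (subst (asm) AE_restrict_space_iff) (auto elim!: eventually_mono simp: indicator_def)
  have meas: "(\<lambda>x. indicat_real S x *\<^sub>R h x) \<in> borel_measurable borel" by measurable
  then have meas': "(\<lambda>x. indicat_real S x *\<^sub>R h x) \<in> borel_measurable lebesgue"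
    by (simp add: measurable_completion)
  have "(\<integral>x. f x \<partial>lebesgue_on S) = (\<integral>x. indicat_real S x *\<^sub>R f x \<partial>lebesgue)"
    by (subst integral_restrict_space) auto
  also have "\<dots> = (\<integral>x. indicat_real S x *\<^sub>R h x \<partial>lebesgue)"
    by (intro integral_cong_AE borel_measurable_AE[OF meas' ae'] meas') (use ae' in \<open>auto elim: eventually_mono\<close>)
  also have "\<dots> = (\<integral>x. indicat_real S x *\<^sub>R h x \<partial>lborel)"
    using meas by (intro integral_completion) simp
  finally show ?thesis .
qed

lemma norm_mollify_le:
  fixes g :: "'a::euclidean_space \<Rightarrow> 'b::euclidean_space"
  assumes "0 < e" "integrable lborel g"
  shows "norm (mollify e g x) \<le> bump_kernel e (0::'a) * (\<integral>y. norm (g y) \<partial>lborel)"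
proof -
  have "norm (mollify e g x) \<le> (\<integral>y. norm (bump_kernel e (x - y) *\<^sub>R g y) \<partial>lborel)"
    unfolding mollify_def by (rule integral_norm_bound)
  also have "\<dots> \<le> (\<integral>y. bump_kernel e (0::'a) * norm (g y) \<partial>lborel)"
  proof (rule integral_mono)
    show "norm (bump_kernel e (x - y) *\<^sub>R g y) \<le> bump_kernel e (0::'a) * norm (g y)" for y
      using kernel_nonneg[OF assms(1), of "x - y"] kernel_le[OF assms(1), of "x - y"] by (simp add: mult_right_mono)
  qed (use assms integrable_kernel_scaleR[OF assms] in \<open>auto simp del: norm_scaleR\<close>)
  finally show ?thesis by simp
qed

lemma green_domain_measurable_id:
  assumes "green_domain U \<sigma> \<nu>"
  shows "(\<lambda>y. y) \<in> measurable \<sigma> borel"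
proof -
  have "sets \<sigma> = sets (restrict_space borel (frontier U))" using assms by (simp add: green_domain_def)
  then show ?thesis
    by (subst measurable_cong_sets[OF _ refl]) (auto intro: measurable_restrict_space1)
qed

lemma green_domain_space:
  assumes "green_domain U \<sigma> \<nu>"
  shows "space \<sigma> = frontier U"
proof -
  have "sets \<sigma> = sets (restrict_space borel (frontier U))" using assms by (simp add: green_domain_def)
  from sets_eq_imp_space_eq[OF this] show ?thesis by (simp add: space_restrict_space)
qed

lemma green_domain_integrable_normal:
  assumes "green_domain U \<sigma> \<nu>"
  shows "integrable \<sigma> (\<lambda>y. \<nu> y $ j)"
proof -
  interpret finite_measure \<sigma> using assms by (simp add: green_domain_def)
  have [measurable]: "\<nu> \<in> borel_measurable \<sigma>" and ae: "AE y in \<sigma>. norm (\<nu> y) = 1"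
    using assms by (auto simp: green_domain_def)
  have "(\<lambda>y. \<nu> y \<bullet> axis j 1) \<in> borel_measurable \<sigma>" by measurable
  then show ?thesis
    using ae by (intro integrable_const_bound[where B = 1]) (auto simp: inner_axis elim!: eventually_mono, metis component_le_norm_cart)
qed

text \<open>The Green formula at scale \<open>e\<close>. Cutting the coefficients off outside \<open>K\<close> changes nothing, since the
test function \<open>mollify e (indicat_real U) f\<close> and its gradient vanish there, but it makes the
mollified functions integrable on the whole space.\<close>

lemma mollified_green_identity:
  fixes A :: "'n::finite \<Rightarrow> real^'n \<Rightarrow> 'e::euclidean_space \<Rightarrow>\<^sub>L 'f::euclidean_space"
  assumes \<Omega>: "open \<Omega>" and A: "\<And>j. smooth_on (A j) \<Omega>" and B: "smooth_on B \<Omega>"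
    and weak: "\<And>\<phi>. C1_compact_support \<Omega> \<phi> \<Longrightarrow> (\<integral>x. u x \<bullet> formal_adjoint A B \<phi> x \<partial>lebesgue_on \<Omega>) = 0"
    and v: "v \<in> borel_measurable borel" and vu: "AE x in lebesgue_on \<Omega>. v x = u x"
    and K: "compact K" "K \<subseteq> \<Omega>" and int: "integrable lborel (\<lambda>x. indicat_real K x *\<^sub>R v x)"
    and green: "green_domain U \<sigma> \<nu>" and "0 < e" and UK: "(\<Union>x\<in>closure U. cball x e) \<subseteq> K"
  shows "(\<Sum>j\<in>UNIV. \<integral>y. \<nu> y $ j * mollify e (\<lambda>x. (indicat_real K x *\<^sub>R A j x (v x)) \<bullet> f) y \<partial>\<sigma>)
    + (\<integral>y. mollify e (\<lambda>x. (indicat_real K x *\<^sub>R (B x - div_symbol A x) (v x)) \<bullet> f) y \<partial>restrict_space lborel U) = 0"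
proof -
  have U: "bounded U" "open U" using green by (auto simp: green_domain_def)
  then have Ub[measurable]: "U \<in> sets borel" by simp
  have [measurable]: "K \<in> sets borel" "\<Omega> \<in> sets borel" using K \<Omega> by (auto intro: borel_compact)
  define \<Phi> d where "\<Phi> = mollify e (indicat_real U)" and "d = mollified_indicator_grad e U"
  define a where "a j x = (indicat_real K x *\<^sub>R A j x (v x)) \<bullet> f" for j x
  define b where "b x = (indicat_real K x *\<^sub>R (B x - div_symbol A x) (v x)) \<bullet> f" for x
  have contA: "continuous_on K (A j)" for j
    using A K(2) by (blast intro: continuous_on_subset smooth_on_continuous)
  have contB: "continuous_on K (\<lambda>x. B x - div_symbol A x)"
    using A B K(2) by (blast intro: continuous_on_subset continuous_on_diff smooth_on_continuous continuous_on_div_symbol)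
  have a: "integrable lborel (a j)" for j
    unfolding a_def by (intro integrable_inner_left integrable_indicator_blinfun_apply contA K v int)
  have b: "integrable lborel b"
    unfolding b_def
    by (rule integrable_inner_left, rule integrable_indicator_blinfun_apply[OF contB K(1) v int])
  have \<Phi>d: "(\<Phi> has_derivative (\<lambda>h. d x \<bullet> h)) (at x)" for x
    unfolding \<Phi>_def d_def by (rule has_derivative_mollified_indicator[OF \<open>0 < e\<close> U(1) Ub])
  have d_cont: "continuous_on S d" for S
    unfolding d_def by (rule continuous_mollified_indicator_grad[OF \<open>0 < e\<close> U(1) Ub])
  have far: "e \<le> norm (x - y)" if "x \<notin> K" "y \<in> U" for x y
  proof (rule ccontr)
    assume "\<not> e \<le> norm (x - y)"
    then have "x \<in> cball y e" by (simp add: dist_norm norm_minus_commute)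
    moreover have "y \<in> closure U" using that(2) closure_subset by blast
    ultimately show False using UK that(1) by blast
  qed
  have \<Phi>0: "\<Phi> x = 0" if "x \<notin> K" for x
  proof -
    have "bump_kernel e (x - y) *\<^sub>R indicat_real U y = 0" for y
      using far[OF that, of y] kernel_eq_0[OF \<open>0 < e\<close>, of "x - y"] by (auto simp: indicator_def)
    then have "\<Phi> x = (\<integral>y. 0 \<partial>(lborel :: (real^'n) measure))" unfolding \<Phi>_def mollify_def by (simp only:)
    then show ?thesis by simp
  qed
  have d0: "d x = 0" if "x \<notin> K" for x
  proof -
    have "indicat_real U y *\<^sub>R kernel_grad e (x - y) = 0" for y
      using far[OF that, of y] kernel_grad_eq_0[OF \<open>0 < e\<close>, of "x - y"] by (auto simp: indicator_def)
    then have "d x = (\<integral>y. 0 \<partial>(lborel :: (real^'n) measure))" unfolding d_def mollified_indicator_grad_def by (simp only:)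
    then show ?thesis by simp
  qed
  have test: "C1_compact_support \<Omega> (\<lambda>x. \<Phi> x *\<^sub>R f)"
  proof -
    have D: "((\<lambda>y. \<Phi> y *\<^sub>R f) has_derivative (\<lambda>h. (d x \<bullet> h) *\<^sub>R f)) (at x)" for x
      by (intro derivative_intros \<Phi>d)
    then have pd: "partial_deriv j (\<lambda>y. \<Phi> y *\<^sub>R f) = (\<lambda>x. (d x $ j) *\<^sub>R f)" for j
      by (intro ext) (simp add: partial_deriv_eqI[OF D] inner_axis)
    have "C_k_on 1 (\<lambda>x. \<Phi> x *\<^sub>R f) \<Omega>"
      unfolding One_nat_def C_k_on.simps pd
    proof (intro conjI ballI allI)
      show "(\<lambda>x. \<Phi> x *\<^sub>R f) differentiable at x" for x using D[of x] by (rule differentiableI)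
      show "continuous_on \<Omega> (\<lambda>x. (d x $ j) *\<^sub>R f)" for j
        by (intro continuous_on_scaleR continuous_on_component continuous_on_const d_cont)
    qed
    moreover have "\<exists>K. compact K \<and> K \<subseteq> \<Omega> \<and> (\<forall>x\<in>\<Omega> - K. \<Phi> x *\<^sub>R f = 0)"
      using K \<Phi>0 by (intro exI[of _ K]) auto
    ultimately show ?thesis by (simp only: C1_compact_support_def)
  qed
  \<comment> \<open>A Borel function that agrees with the integrand of the weak equation almost everywhere in \<open>\<Omega>\<close>.\<close>
  define h where "h x = \<Phi> x * b x - (\<Sum>j\<in>UNIV. d x $ j * a j x)" for x
  have [measurable]: "\<Phi> \<in> borel_measurable borel" "b \<in> borel_measurable borel" "\<And>j. a j \<in> borel_measurable borel"
    using a b by (auto simp: \<Phi>_def)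
  have [measurable]: "(\<lambda>x. d x $ j) \<in> borel_measurable borel" for j
    by (intro borel_measurable_continuous_onI continuous_on_component d_cont)
  have h_meas: "h \<in> borel_measurable borel" unfolding h_def by measurable
  have hout: "h x = 0" if "x \<notin> K" for x
    by (simp add: h_def \<Phi>0[OF that] d0[OF that])
  have "AE x in lebesgue_on \<Omega>. x \<in> \<Omega>"
    using AE_space[of "lebesgue_on \<Omega>"] by simp
  with vu have ae: "AE x in lebesgue_on \<Omega>. u x \<bullet> formal_adjoint A B (\<lambda>y. \<Phi> y *\<^sub>R f) x = h x"
  proof eventually_elim
    fix x assume x: "v x = u x" "x \<in> \<Omega>"
    have eq: "u x \<bullet> formal_adjoint A B (\<lambda>y. \<Phi> y *\<^sub>R f) x
      = \<Phi> x * ((B x - div_symbol A x) (u x) \<bullet> f) - (\<Sum>j\<in>UNIV. d x $ j * (A j x (u x) \<bullet> f))"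
      by (intro inner_formal_adjoint \<Phi>d smooth_on_differentiable[OF A x(2)])
    show "u x \<bullet> formal_adjoint A B (\<lambda>y. \<Phi> y *\<^sub>R f) x = h x"
      unfolding eq
      by (cases "x \<in> K") (simp_all add: h_def a_def b_def x(1) \<Phi>0 d0)
  qed
  have "0 = (\<integral>x. indicat_real \<Omega> x *\<^sub>R h x \<partial>lborel)"
    using weak[OF test] integral_lebesgue_on_eq_AE[OF _ h_meas ae] by simp
  also have "\<dots> = (\<integral>x. h x \<partial>lborel)"
    using hout K(2) by (intro Bochner_Integration.integral_cong) (auto simp: indicator_def)
  also have "\<dots> = (\<integral>x. \<Phi> x * b x \<partial>lborel) - (\<Sum>j\<in>UNIV. \<integral>x. d x $ j * a j x \<partial>lborel)"
  proof -
    obtain C where C: "\<And>z::real^'n. norm (kernel_grad e z) \<le> C" using kernel_grad_bounded[OF \<open>0 < e\<close>, where 'a="real^'n"] by blast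
    have iU: "integrable lborel (indicat_real U)"
      using emeasure_bounded_finite[OF U(1)] by (intro integrable_real_indicator) auto
    have \<Phi>bd: "\<bar>\<Phi> x\<bar> \<le> bump_kernel e (0::real^'n) * measure lborel U" for x
      using norm_mollify_le[OF \<open>0 < e\<close> iU, of x] by (simp add: \<Phi>_def)
    have i1: "integrable lborel (\<lambda>x. \<Phi> x * b x)"
      by (rule Bochner_Integration.integrable_bound[OF integrable_mult_right[OF b, of "bump_kernel e (0::real^'n) * measure lborel U"]])
         (auto simp: abs_mult intro!: mult_right_mono order_trans[OF \<Phi>bd] AE_I2)
    have "bounded (d ` K)" by (intro compact_imp_bounded compact_continuous_image d_cont K)
    then obtain D where D: "\<forall>x\<in>K. norm (d x) \<le> D" by (auto simp: bounded_iff)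
    have i2: "integrable lborel (\<lambda>x. d x $ j * a j x)" for j
    proof (rule Bochner_Integration.integrable_bound[OF integrable_mult_right[OF a[of j], of D]])
      show "AE x in lborel. norm (d x $ j * a j x) \<le> norm (D * a j x)"
      proof (rule AE_I2)
        fix x
        show "norm (d x $ j * a j x) \<le> norm (D * a j x)"
        proof (cases "x \<in> K")
          case True
          then have "\<bar>d x $ j\<bar> \<le> \<bar>D\<bar>" using D component_le_norm_cart[of "d x" j] by fastforce
          then show ?thesis by (simp add: abs_mult mult_right_mono)
        qed (simp add: d0)
      qed
    qed simp
    show ?thesis unfolding h_def using i1 i2 by simp
  qed
  also have "(\<integral>x. \<Phi> x * b x \<partial>lborel) = (\<integral>y. mollify e b y \<partial>restrict_space lborel U)"
  proof -
    have fin: "finite_measure (restrict_space lborel U)"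
      using emeasure_bounded_finite[OF U(1)]
      by (intro finite_measureI) (simp add: emeasure_restrict_space space_restrict_space)
    have "\<Phi> x = (\<integral>y. 1 * bump_kernel e (x - y) \<partial>restrict_space lborel U)" for x
      by (subst integral_restrict_space) (simp_all add: \<Phi>_def mollify_def mult.commute)
    then have "(\<integral>x. \<Phi> x * b x \<partial>lborel) = (\<integral>x. b x * (\<integral>y. 1 * bump_kernel e (x - y) \<partial>restrict_space lborel U) \<partial>lborel)"
      by (simp add: mult.commute)
    also have "\<dots> = (\<integral>y. 1 * mollify e b y \<partial>restrict_space lborel U)"
      by (intro mollify_Fubini fin b \<open>0 < e\<close> finite_measure.integrable_const) (auto intro: measurable_restrict_space1)
    finally show ?thesis by simp
  qed
  finally have "0 = (\<integral>y. mollify e b y \<partial>restrict_space lborel U) - (\<Sum>j\<in>UNIV. \<integral>x. d x $ j * a j x \<partial>lborel)" .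
  moreover have "(\<integral>x. d x $ j * a j x \<partial>lborel) = - (\<integral>y. \<nu> y $ j * mollify e (a j) y \<partial>\<sigma>)" for j
  proof -
    have "(\<integral>x. d x $ j * a j x \<partial>lborel) = - (\<integral>x. a j x * (\<integral>y. \<nu> y $ j * bump_kernel e (x - y) \<partial>\<sigma>) \<partial>lborel)"
      unfolding d_def green_domain_kernel[OF green \<open>0 < e\<close>] by (simp add: mult.commute)
    also have "(\<integral>x. a j x * (\<integral>y. \<nu> y $ j * bump_kernel e (x - y) \<partial>\<sigma>) \<partial>lborel) = (\<integral>y. \<nu> y $ j * mollify e (a j) y \<partial>\<sigma>)"
      using green
      by (intro mollify_Fubini green_domain_measurable_id[OF green] green_domain_integrable_normal[OF green] a \<open>0 < e\<close>)
         (simp add: green_domain_def)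
    finally show ?thesis .
  qed
  ultimately show ?thesis by (simp add: sum_negf a_def[abs_def] b_def[abs_def])
qed

section \<open>Convergence on almost every Green boundary\<close>

lemma mollify_cong:
  fixes g g' :: "'a::euclidean_space \<Rightarrow> 'b::euclidean_space"
  assumes "0 < e" "\<And>y. y \<in> cball x e \<Longrightarrow> g y = g' y"
  shows "mollify e g x = mollify e g' x"
proof -
  have "bump_kernel e (x - y) *\<^sub>R g y = bump_kernel e (x - y) *\<^sub>R g' y" for y
    using assms(2)[of y] kernel_eq_0[OF assms(1), of "x - y"] by (cases "y \<in> cball x e") (auto simp: dist_norm)
  then show ?thesis unfolding mollify_def by (simp only:)
qed

lemma norm_mollify_le_ess_bound:
  fixes g :: "'a::euclidean_space \<Rightarrow> 'b::euclidean_space"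
  assumes "0 < e" "integrable lborel g" and M: "AE y in lborel. norm (g y) \<le> M"
  shows "norm (mollify e g x) \<le> M"
proof -
  have [measurable]: "g \<in> borel_measurable borel" using assms(2) by auto
  have i: "integrable lborel (\<lambda>y. bump_kernel e (x - y))"
  proof -
    have "integrable lborel (\<lambda>z. bump_kernel e (z + (- x)))"
      by (intro integrable_lborel_translate integrable_kernel \<open>0 < e\<close>)
    then show ?thesis by (simp add: kernel_minus[OF \<open>0 < e\<close>, of x])
  qed
  have one: "(\<integral>y. bump_kernel e (x - y) \<partial>lborel) = 1"
    using integral_lborel_translate[OF measurable_kernel, of e "- x"] integral_kernel[OF \<open>0 < e\<close>, where 'a='a]
    by (simp add: kernel_minus[OF \<open>0 < e\<close>, of x])
  have "norm (mollify e g x) \<le> (\<integral>y. norm (bump_kernel e (x - y) *\<^sub>R g y) \<partial>lborel)"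
    unfolding mollify_def by (rule integral_norm_bound)
  also have "\<dots> \<le> (\<integral>y. bump_kernel e (x - y) * M \<partial>lborel)"
  proof (rule integral_mono_AE)
    show "AE y in lborel. norm (bump_kernel e (x - y) *\<^sub>R g y) \<le> bump_kernel e (x - y) * M"
      using M by eventually_elim (use kernel_nonneg[OF \<open>0 < e\<close>, where 'a='a] in \<open>simp add: mult_left_mono\<close>)
  qed (use i integrable_kernel_scaleR[OF assms(1,2)] in \<open>auto simp del: norm_scaleR\<close>)
  also have "\<dots> = M" using one by simp
  finally show ?thesis .
qed

lemma in_Lp_lborel:
  fixes f :: "real^'n::finite \<Rightarrow> 'b::euclidean_space"
  assumes f: "f \<in> borel_measurable borel"
  shows "in_Lp p UNIV f \<longleftrightarrow> (if p = \<infinity> then (\<exists>C. AE x in lborel. norm (f x) \<le> C)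
      else (\<integral>\<^sup>+x. ennreal (norm (f x) powr enn2real p) \<partial>lborel) < \<infinity>)"
  using measurable_completion[of f lborel borel] f unfolding in_Lp_def lebesgue_on_UNIV_eq
  by (simp add: nn_integral_completion AE_completion_iff)

text \<open>The weight is \<open>\<rho> = (\<Sum>m. (2\<^sup>m r\<^sub>m)\<^sup>p)\<^sup>1\<^sup>/\<^sup>p\<close>. It dominates every \<open>2\<^sup>m r\<^sub>m\<close>, and its \<open>p\<close>-th power is
integrated termwise.\<close>

lemma fuglede_weight:
  fixes r :: "nat \<Rightarrow> real^'n::finite \<Rightarrow> real"
  assumes p: "1 \<le> p" "p \<noteq> \<infinity>" and [measurable]: "\<And>m. r m \<in> borel_measurable borel" and r0: "\<And>m x. 0 \<le> r m x"
    and small: "\<And>m. (\<integral>\<^sup>+x. ennreal (r m x powr enn2real p) \<partial>lborel) \<le> ennreal ((1 / 4 ^ m) powr enn2real p)"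
  shows "\<exists>\<rho> :: real^'n \<Rightarrow> ennreal. \<rho> \<in> borel_measurable borel \<and> (AE x in lebesgue. \<rho> x \<noteq> \<infinity>) \<and>
    in_Lp p UNIV (\<lambda>x. enn2real (\<rho> x)) \<and> (\<forall>m x. ennreal (r m x) \<le> ennreal ((1 / 2) ^ m) * \<rho> x)"
proof -
  define q where "q = enn2real p"
  have q: "1 \<le> q" using p unfolding q_def by (metis enn2real_1 enn2real_mono infinity_ennreal_def less_top)
  define S where "S x = (\<Sum>m. ennreal ((2 ^ m * r m x) powr q))" for x
  have [measurable]: "S \<in> borel_measurable borel" unfolding S_def by measurable
  have "(\<integral>\<^sup>+x. S x \<partial>lborel) = (\<Sum>m. \<integral>\<^sup>+x. ennreal ((2 ^ m * r m x) powr q) \<partial>lborel)"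
    unfolding S_def by (rule nn_integral_suminf) measurable
  also have "\<dots> \<le> (\<Sum>m. ennreal ((1 / 2) ^ m))"
  proof (intro suminf_le summableI)
    fix m
    have "(\<integral>\<^sup>+x. ennreal ((2 ^ m * r m x) powr q) \<partial>lborel) = ennreal ((2 ^ m) powr q) * (\<integral>\<^sup>+x. ennreal (r m x powr q) \<partial>lborel)"
      by (simp add: powr_mult r0 ennreal_mult nn_integral_cmult)
    also have "\<dots> \<le> ennreal ((2 ^ m) powr q) * ennreal ((1 / 4 ^ m) powr q)"
      using small[of m] unfolding q_def by (intro mult_left_mono) auto
    also have "\<dots> = ennreal ((2 ^ m * (1 / 4 ^ m)) powr q)"
      by (subst powr_mult) (simp_all add: ennreal_mult del: times_divide_eq_right)
    also have "2 ^ m * (1 / 4 ^ m) = (1 / 2 :: real) ^ m"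
      by (simp add: power_divide power_mult_distrib[symmetric] field_simps)
    also have "((1 / 2 :: real) ^ m) powr q \<le> ((1 / 2) ^ m) powr 1"
      by (rule powr_mono') (use q in \<open>auto simp: power_le_one\<close>)
    finally show "(\<integral>\<^sup>+x. ennreal ((2 ^ m * r m x) powr q) \<partial>lborel) \<le> ennreal ((1 / 2) ^ m)"
      by (simp add: ennreal_leI)
  qed
  also have "\<dots> < \<infinity>"
    by (subst suminf_ennreal_eq[OF _ geometric_sums]) auto
  finally have intS: "(\<integral>\<^sup>+x. S x \<partial>lborel) < \<infinity>" .
  define \<rho> where "\<rho> x = (if S x = \<infinity> then \<infinity> else ennreal (enn2real (S x) powr (1 / q)))" for x
  have m\<rho>[measurable]: "\<rho> \<in> borel_measurable borel" unfolding \<rho>_def by measurable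
  have "AE x in lborel. S x \<noteq> \<infinity>"
    using intS by (intro nn_integral_noteq_infinite) auto
  then have "AE x in lborel. \<rho> x \<noteq> \<infinity>" by eventually_elim (simp add: \<rho>_def)
  moreover have "in_Lp p UNIV (\<lambda>x. enn2real (\<rho> x))"
  proof -
    have "(\<integral>\<^sup>+x. ennreal (norm (enn2real (\<rho> x)) powr q) \<partial>lborel) \<le> (\<integral>\<^sup>+x. S x \<partial>lborel)"
    proof (rule nn_integral_mono)
      fix x
      show "ennreal (norm (enn2real (\<rho> x)) powr q) \<le> S x"
        using q by (cases "S x") (auto simp: \<rho>_def powr_powr)
    qed
    then show ?thesis
      using intS p(2) by (subst in_Lp_lborel) (auto simp: q_def intro: le_less_trans)
  qed
  moreover have "ennreal (r m x) \<le> ennreal ((1 / 2) ^ m) * \<rho> x" for m x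
  proof (cases "S x = \<infinity>")
    case True
    then show ?thesis by (simp add: \<rho>_def ennreal_mult_top)
  next
    case False
    have "(\<Sum>k\<in>{m}. ennreal ((2 ^ k * r k x) powr q)) \<le> S x"
      unfolding S_def by (rule sum_le_suminf) (auto intro: summableI)
    then have "ennreal ((2 ^ m * r m x) powr q) \<le> S x" by simp
    then have "(2 ^ m * r m x) powr q \<le> enn2real (S x)"
      using False by (cases "S x") auto
    then have "((2 ^ m * r m x) powr q) powr (1 / q) \<le> enn2real (S x) powr (1 / q)"
      using q by (intro powr_mono2) auto
    moreover have "((2 ^ m * r m x) powr q) powr (1 / q) = 2 ^ m * r m x"
      using q r0[of m x] by (simp add: powr_powr)
    ultimately have le: "2 ^ m * r m x \<le> enn2real (S x) powr (1 / q)" by (simp only:)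
    have "(1 / 2) ^ m * 2 ^ m = (1 :: real)" by (simp add: power_mult_distrib[symmetric])
    then have "r m x = (1 / 2) ^ m * (2 ^ m * r m x)" by (simp only: mult.assoc[symmetric] mult_1)
    also have "\<dots> \<le> (1 / 2) ^ m * enn2real (S x) powr (1 / q)" using le by (intro mult_left_mono) auto
    finally show ?thesis using False by (simp add: \<rho>_def ennreal_mult[symmetric] ennreal_leI)
  qed
  ultimately show ?thesis using m\<rho> by (intro exI[of _ \<rho>]) (simp add: AE_completion_iff)
qed

lemma measurable_on_green_boundary:
  assumes "green_domain U \<sigma> \<nu>" "f \<in> borel_measurable borel"
  shows "f \<in> borel_measurable \<sigma>"
  using measurable_compose[OF green_domain_measurable_id[OF assms(1)] assms(2)] by simp

text \<open>The bound \<open>4\<^sup>-\<^sup>m\<close> leaves a geometric series after multiplication by the factors \<open>2\<^sup>m\<close> of the weight in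
\<open>fuglede_weight\<close>.\<close>

lemma choose_mollification_scales:
  fixes g :: "nat \<Rightarrow> 'a::euclidean_space \<Rightarrow> 'b::euclidean_space"
  assumes "\<And>m. integrable lborel (g m)" "1 \<le> q" "\<And>m. (\<integral>\<^sup>+x. ennreal (norm (g m x) powr q) \<partial>lborel) < \<infinity>"
  shows "\<exists>\<epsilon>. (\<forall>m. 0 < \<epsilon> m) \<and> \<epsilon> \<longlonglongrightarrow> 0 \<and>
    (\<forall>m. (\<integral>\<^sup>+x. ennreal (norm (mollify (\<epsilon> m) (g m) x - g m x) powr q) \<partial>lborel) \<le> ennreal ((1 / 4 ^ m) powr q))"
proof -
  have "\<exists>d>0. \<forall>e. 0 < e \<and> e \<le> d \<longrightarrow>
      (\<integral>\<^sup>+x. ennreal (norm (mollify e (g m) x - g m x) powr q) \<partial>lborel) \<le> ennreal ((1 / 4 ^ m) powr q)" for m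
    by (rule mollify_tendsto_Lp) (use assms in auto)
  then obtain d where d: "\<And>m. 0 < d m" "\<And>m e. 0 < e \<Longrightarrow> e \<le> d m \<Longrightarrow>
      (\<integral>\<^sup>+x. ennreal (norm (mollify e (g m) x - g m x) powr q) \<partial>lborel) \<le> ennreal ((1 / 4 ^ m) powr q)"
    by metis
  define \<epsilon> where "\<epsilon> m = min (d m) (inverse (real (Suc m)))" for m
  have pos: "0 < \<epsilon> m" for m using d(1)[of m] by (simp add: \<epsilon>_def)
  moreover have "\<epsilon> \<longlonglongrightarrow> 0"
    by (rule Lim_null_comparison[OF _ LIMSEQ_inverse_real_of_nat])
       (use pos in \<open>auto simp: \<epsilon>_def abs_of_pos intro!: always_eventually\<close>)
  moreover have "\<epsilon> m \<le> d m" for m by (simp add: \<epsilon>_def)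
  ultimately show ?thesis using d(2) by (intro exI[of _ \<epsilon>]) auto
qed

text \<open>The weight \<open>\<rho>\<close> witnesses that the Green boundaries on which the mollified functions fail to converge
to \<open>G\<close> in \<open>L\<^sup>1 \<sigma>\<close> form a \<open>p\<close>-exceptional family.\<close>

definition mollification_weight ::
  "ennreal \<Rightarrow> (real^'n::finite) set \<Rightarrow> (nat \<Rightarrow> real) \<Rightarrow> (nat \<Rightarrow> real^'n \<Rightarrow> 'b::euclidean_space)
     \<Rightarrow> (real^'n \<Rightarrow> 'b) \<Rightarrow> (real^'n \<Rightarrow> ennreal) \<Rightarrow> bool" where
  "mollification_weight p \<Omega> \<epsilon> g G \<rho> \<longleftrightarrow>
     \<rho> \<in> borel_measurable borel \<and> (AE x in lebesgue. \<rho> x \<noteq> \<infinity>) \<and> in_Lp p UNIV (\<lambda>x. enn2real (\<rho> x)) \<and>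
     (\<forall>U \<sigma> \<nu>. green_domain U \<sigma> \<nu> \<and> closure U \<subseteq> \<Omega> \<and> (\<integral>\<^sup>+y. \<rho> y \<partial>\<sigma>) < \<infinity> \<longrightarrow>
        integrable \<sigma> G \<and> (\<lambda>m. \<integral>y. norm (mollify (\<epsilon> m) (g m) y - G y) \<partial>\<sigma>) \<longlonglongrightarrow> 0)"

text \<open>Since \<open>G\<close> belongs to \<open>L\<^sup>p\<close> only locally, it is cut off by an exhausting sequence of compact sets \<open>C m\<close>,
and the cut-off with number \<open>m\<close> is mollified at the scale with number \<open>m\<close>. Near a given Green
domain all but finitely many of the cut-offs coincide with \<open>G\<close>, so that one sequence of scales, and
hence one weight, serves all Green domains.\<close>

context
  fixes \<Omega> :: "(real^'n::finite) set" and C :: "nat \<Rightarrow> (real^'n) set"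
    and G :: "real^'n \<Rightarrow> 'b::euclidean_space" and g :: "nat \<Rightarrow> real^'n \<Rightarrow> 'b"
  assumes exhaust: "\<And>L. compact L \<Longrightarrow> L \<subseteq> \<Omega> \<Longrightarrow> \<exists>N. \<exists>\<delta>>0. \<forall>n\<ge>N. (\<Union>x\<in>L. cball x \<delta>) \<subseteq> C n"
    and g_def: "\<And>m x. g m x = indicat_real (C m) x *\<^sub>R G x"
    and g_int: "\<And>m. integrable lborel (g m)"
begin

lemma cut_off_eventually_eq:
  assumes "green_domain U \<sigma> \<nu>" "closure U \<subseteq> \<Omega>"
  shows "\<exists>N. \<exists>\<delta>>0. \<forall>m\<ge>N. \<forall>x\<in>closure U. \<forall>y\<in>cball x \<delta>. g m y = G y"
proof -
  have "compact (closure U)" using assms(1) by (simp add: green_domain_def)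
  from exhaust[OF this assms(2)] obtain N \<delta> where "0 < \<delta>" and N: "\<forall>n\<ge>N. (\<Union>x\<in>closure U. cball x \<delta>) \<subseteq> C n" by blast
  then show ?thesis
    by (intro exI[of _ N] exI[of _ \<delta>]) (auto simp: g_def indicator_def)
qed

text \<open>On the boundary of \<open>U\<close> the difference between a cut-off and its mollification is integrable because it
lies below a multiple of the weight, and the mollification is bounded; hence \<open>G\<close> is integrable.\<close>

lemma mollification_weight_finite_exponent:
  assumes p: "1 \<le> p" "p \<noteq> \<infinity>"
    and Lp: "\<And>m. (\<integral>\<^sup>+x. ennreal (norm (g m x) powr enn2real p) \<partial>lborel) < \<infinity>"
  shows "\<exists>\<epsilon> \<rho>. (\<forall>m. 0 < \<epsilon> m) \<and> \<epsilon> \<longlonglongrightarrow> 0 \<and> mollification_weight p \<Omega> \<epsilon> g G \<rho>"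
proof -
  have "1 \<le> enn2real p" using p by (metis enn2real_1 enn2real_mono infinity_ennreal_def less_top)
  from choose_mollification_scales[of g, OF g_int this Lp]
  obtain \<epsilon> where \<epsilon>: "\<And>m. 0 < \<epsilon> m" "\<epsilon> \<longlonglongrightarrow> 0"
      "\<And>m. (\<integral>\<^sup>+x. ennreal (norm (mollify (\<epsilon> m) (g m) x - g m x) powr enn2real p) \<partial>lborel) \<le> ennreal ((1 / 4 ^ m) powr enn2real p)"
    by blast
  have gm[measurable]: "g m \<in> borel_measurable borel" for m using g_int[of m] by auto
  define r where "r m x = norm (mollify (\<epsilon> m) (g m) x - g m x)" for m x
  have rm[measurable]: "r m \<in> borel_measurable borel" for m unfolding r_def by measurable
  have "\<exists>\<rho> :: real^'n \<Rightarrow> ennreal. \<rho> \<in> borel_measurable borel \<and> (AE x in lebesgue. \<rho> x \<noteq> \<infinity>) \<and>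
    in_Lp p UNIV (\<lambda>x. enn2real (\<rho> x)) \<and> (\<forall>m x. ennreal (r m x) \<le> ennreal ((1 / 2) ^ m) * \<rho> x)"
    by (rule fuglede_weight[OF p rm]) (use \<epsilon>(3) in \<open>auto simp: r_def\<close>)
  then obtain \<rho> :: "real^'n \<Rightarrow> ennreal" where \<rho>: "\<rho> \<in> borel_measurable borel" "AE x in lebesgue. \<rho> x \<noteq> \<infinity>"
    "in_Lp p UNIV (\<lambda>x. enn2real (\<rho> x))" "\<And>m x. ennreal (r m x) \<le> ennreal ((1 / 2) ^ m) * \<rho> x"
    by blast
  have "integrable \<sigma> G \<and> (\<lambda>m. \<integral>y. norm (mollify (\<epsilon> m) (g m) y - G y) \<partial>\<sigma>) \<longlonglongrightarrow> 0"
    if green: "green_domain U \<sigma> \<nu>" and U: "closure U \<subseteq> \<Omega>" and fin: "(\<integral>\<^sup>+y. \<rho> y \<partial>\<sigma>) < \<infinity>" for U \<sigma> \<nu>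
  proof -
    interpret finite_measure \<sigma> using green by (simp add: green_domain_def)
    note meas = measurable_on_green_boundary[OF green]
    obtain N \<delta> where "0 < \<delta>" and N: "\<forall>m\<ge>N. \<forall>x\<in>closure U. \<forall>y\<in>cball x \<delta>. g m y = G y"
      using cut_off_eventually_eq[OF green U] by blast
    have eq: "g m y = G y" if "N \<le> m" "y \<in> space \<sigma>" for m y
      using N that \<open>0 < \<delta>\<close> by (auto simp: green_domain_space[OF green] frontier_def)
    have bound: "(\<integral>\<^sup>+y. ennreal (r m y) \<partial>\<sigma>) \<le> ennreal ((1 / 2) ^ m) * (\<integral>\<^sup>+y. \<rho> y \<partial>\<sigma>)" for m
      using nn_integral_mono[of \<sigma> "\<lambda>y. ennreal (r m y)" "\<lambda>y. ennreal ((1 / 2) ^ m) * \<rho> y"] \<rho>(4)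
      by (simp add: nn_integral_cmult meas[OF \<rho>(1)])
    have r_int: "integrable \<sigma> (r m)" for m
    proof (rule integrableI_bounded)
      show "(\<integral>\<^sup>+y. ennreal (norm (r m y)) \<partial>\<sigma>) < \<infinity>"
        using bound[of m] fin by (auto simp: r_def ennreal_mult_less_top intro: le_less_trans)
    qed (rule meas[OF rm])
    have d_int: "integrable \<sigma> (\<lambda>y. mollify (\<epsilon> m) (g m) y - g m y)" for m
    proof -
      have "integrable \<sigma> (\<lambda>y. norm (mollify (\<epsilon> m) (g m) y - g m y))"
        using r_int[of m] unfolding r_def[abs_def] .
      then show ?thesis
        by (subst (asm) integrable_norm_iff)
           (intro borel_measurable_diff meas[OF measurable_mollify[OF gm]] meas[OF gm])
    qed
    have m_int: "integrable \<sigma> (mollify (\<epsilon> m) (g m))" for m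
      by (rule integrable_const_bound[OF AE_I2[OF norm_mollify_le[OF \<epsilon>(1) g_int]]]) (rule meas[OF measurable_mollify[OF gm]])
    have "integrable \<sigma> (g N)"
      using Bochner_Integration.integrable_diff[OF m_int[of N] d_int[of N]] by simp
    moreover have "integrable \<sigma> G \<longleftrightarrow> integrable \<sigma> (g N)"
      by (rule Bochner_Integration.integrable_cong) (auto simp: eq)
    ultimately have "integrable \<sigma> G" by simp
    moreover have "(\<lambda>m. \<integral>y. norm (mollify (\<epsilon> m) (g m) y - G y) \<partial>\<sigma>) \<longlonglongrightarrow> 0"
    proof (rule Lim_null_comparison)
      show "\<forall>\<^sub>F m in sequentially. norm (\<integral>y. norm (mollify (\<epsilon> m) (g m) y - G y) \<partial>\<sigma>) \<le> (1 / 2) ^ m * enn2real (\<integral>\<^sup>+y. \<rho> y \<partial>\<sigma>)"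
        using eventually_ge_at_top[of N]
      proof eventually_elim
        fix m assume m: "N \<le> m"
        have "(\<integral>y. norm (mollify (\<epsilon> m) (g m) y - G y) \<partial>\<sigma>) = (\<integral>y. r m y \<partial>\<sigma>)"
          by (rule Bochner_Integration.integral_cong) (auto simp: r_def eq[OF m])
        moreover have "ennreal (\<integral>y. r m y \<partial>\<sigma>) \<le> ennreal ((1 / 2) ^ m) * (\<integral>\<^sup>+y. \<rho> y \<partial>\<sigma>)"
          using bound[of m] by (subst nn_integral_eq_integral[OF r_int[of m], symmetric]) (simp_all add: r_def)
        then have "(\<integral>y. r m y \<partial>\<sigma>) \<le> (1 / 2) ^ m * enn2real (\<integral>\<^sup>+y. \<rho> y \<partial>\<sigma>)"
          using fin by (cases "\<integral>\<^sup>+y. \<rho> y \<partial>\<sigma>") (auto simp: ennreal_mult[symmetric])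
        moreover have "0 \<le> (\<integral>y. r m y \<partial>\<sigma>)" by (rule Bochner_Integration.integral_nonneg) (simp add: r_def)
        ultimately show "norm (\<integral>y. norm (mollify (\<epsilon> m) (g m) y - G y) \<partial>\<sigma>) \<le> (1 / 2) ^ m * enn2real (\<integral>\<^sup>+y. \<rho> y \<partial>\<sigma>)"
          by simp
      qed
      show "(\<lambda>m. (1 / 2) ^ m * enn2real (\<integral>\<^sup>+y. \<rho> y \<partial>\<sigma>)) \<longlonglongrightarrow> 0"
        by (intro tendsto_mult_left_zero LIMSEQ_power_zero) simp
    qed
    ultimately show ?thesis ..
  qed
  then show ?thesis
    using \<epsilon>(1,2) \<rho> unfolding mollification_weight_def by blast
qed

text \<open>The scales are chosen so that the \<open>L\<^sup>1\<close> norms of the differences are summable; then the differences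
are summable almost everywhere. The weight is \<open>\<infinity>\<close> where this fails or where a cut-off exceeds its essential
bound, and \<open>0\<close> elsewhere. As a function that vanishes almost everywhere it belongs to \<open>L\<^sup>\<infinity>\<close>, and a finite integral of it over \<open>\<partial>U\<close> means that \<open>\<sigma>\<close> does not see the set where it is
infinite.\<close>

lemma mollification_weight_infinite_exponent:
  assumes bdd: "\<And>m. \<exists>M. AE x in lborel. norm (g m x) \<le> M"
  shows "\<exists>\<epsilon> \<rho>. (\<forall>m. 0 < \<epsilon> m) \<and> \<epsilon> \<longlonglongrightarrow> 0 \<and> mollification_weight \<infinity> \<Omega> \<epsilon> g G \<rho>"
proof -
  have gm[measurable]: "g m \<in> borel_measurable borel" for m using g_int[of m] by auto
  obtain M where M: "\<And>m. AE x in lborel. norm (g m x) \<le> M m" using bdd by metis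
  have "(\<integral>\<^sup>+x. ennreal (norm (g m x) powr 1) \<partial>lborel) < \<infinity>" for m
    using g_int[of m] by (simp add: integrable_iff_bounded)
  from choose_mollification_scales[of g, OF g_int _ this]
  obtain \<epsilon> where \<epsilon>: "\<And>m. 0 < \<epsilon> m" "\<epsilon> \<longlonglongrightarrow> 0"
      "\<And>m. (\<integral>\<^sup>+x. ennreal (norm (mollify (\<epsilon> m) (g m) x - g m x)) \<partial>lborel) \<le> ennreal (1 / 4 ^ m)"
    by auto
  define r where "r m x = norm (mollify (\<epsilon> m) (g m) x - g m x)" for m x
  have rm[measurable]: "r m \<in> borel_measurable borel" for m unfolding r_def by measurable
  define S where "S x = (\<Sum>m. ennreal (r m x))" for x
  have [measurable]: "S \<in> borel_measurable borel" unfolding S_def by measurable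
  have "(\<integral>\<^sup>+x. S x \<partial>lborel) = (\<Sum>m. \<integral>\<^sup>+x. ennreal (r m x) \<partial>lborel)"
    unfolding S_def by (rule nn_integral_suminf) measurable
  also have "\<dots> \<le> (\<Sum>m. ennreal ((1 / 4) ^ m))"
    using \<epsilon>(3) by (intro suminf_le summableI) (simp add: r_def power_divide)
  also have "\<dots> < \<infinity>"
    by (subst suminf_ennreal_eq[OF _ geometric_sums]) auto
  finally have intS: "(\<integral>\<^sup>+x. S x \<partial>lborel) < \<infinity>" .
  define \<rho> :: "real^'n \<Rightarrow> ennreal" where "\<rho> x = (if S x = \<infinity> \<or> (\<exists>m. M m < norm (g m x)) then \<infinity> else 0)" for x
  have m\<rho>: "\<rho> \<in> borel_measurable borel" unfolding \<rho>_def by measurable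
  have "AE x in lborel. S x \<noteq> \<infinity>" using intS by (intro nn_integral_noteq_infinite) auto
  moreover have "AE x in lborel. \<forall>m. norm (g m x) \<le> M m" using M by (simp add: AE_all_countable)
  ultimately have "AE x in lborel. \<rho> x \<noteq> \<infinity>" by eventually_elim (simp add: \<rho>_def not_less[symmetric])
  then have ae\<rho>: "AE x in lebesgue. \<rho> x \<noteq> \<infinity>" by (simp add: AE_completion_iff)
  have "enn2real (\<rho> x) = 0" for x by (simp add: \<rho>_def)
  then have Lp: "in_Lp \<infinity> UNIV (\<lambda>x. enn2real (\<rho> x))" by (subst in_Lp_lborel) auto
  have "integrable \<sigma> G \<and> (\<lambda>m. \<integral>y. norm (mollify (\<epsilon> m) (g m) y - G y) \<partial>\<sigma>) \<longlonglongrightarrow> 0"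
    if green: "green_domain U \<sigma> \<nu>" and U: "closure U \<subseteq> \<Omega>" and fin: "(\<integral>\<^sup>+y. \<rho> y \<partial>\<sigma>) < \<infinity>" for U \<sigma> \<nu>
  proof -
    interpret finite_measure \<sigma> using green by (simp add: green_domain_def)
    note meas = measurable_on_green_boundary[OF green]
    obtain N \<delta> where "0 < \<delta>" and N: "\<forall>m\<ge>N. \<forall>x\<in>closure U. \<forall>y\<in>cball x \<delta>. g m y = G y"
      using cut_off_eventually_eq[OF green U] by blast
    have sp: "y \<in> closure U" if "y \<in> space \<sigma>" for y using that by (simp add: green_domain_space[OF green] frontier_def)
    have eq: "g m y = G y" if "N \<le> m" "y \<in> space \<sigma>" for m y
      using N that sp[OF that(2)] \<open>0 < \<delta>\<close> by auto
    obtain N' where N': "\<And>m. N' \<le> m \<Longrightarrow> \<epsilon> m \<le> \<delta>"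
      using order_tendstoD(2)[OF \<epsilon>(2) \<open>0 < \<delta>\<close>] unfolding eventually_sequentially by (meson less_imp_le)
    have ae: "AE y in \<sigma>. \<rho> y \<noteq> \<infinity>" using fin meas[OF m\<rho>] by (intro nn_integral_noteq_infinite) auto
    have Gm: "G \<in> borel_measurable \<sigma>"
      using meas[OF gm[of N]] by (subst measurable_cong[of \<sigma> G "g N"]) (auto simp: eq)
    have aeG: "AE y in \<sigma>. norm (G y) \<le> M N"
      using ae AE_space
    proof eventually_elim
      fix y assume "\<rho> y \<noteq> \<infinity>" "y \<in> space \<sigma>"
      then show "norm (G y) \<le> M N" using eq[of N y] by (auto simp: \<rho>_def not_less split: if_splits) metis
    qed
    have "integrable \<sigma> G" by (rule integrable_const_bound[OF aeG Gm])
    moreover have "(\<lambda>m. \<integral>y. norm (mollify (\<epsilon> (m + max N N')) (g (m + max N N')) y - G y) \<partial>\<sigma>) \<longlonglongrightarrow> (\<integral>y. 0 \<partial>\<sigma>)"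
    proof (rule integral_dominated_convergence[where w = "\<lambda>_. 2 * M N"])
      show "AE y in \<sigma>. (\<lambda>m. norm (mollify (\<epsilon> (m + max N N')) (g (m + max N N')) y - G y)) \<longlonglongrightarrow> 0"
        using ae AE_space
      proof eventually_elim
        fix y assume y: "\<rho> y \<noteq> \<infinity>" "y \<in> space \<sigma>"
        then have "S y \<noteq> \<infinity>" by (auto simp: \<rho>_def split: if_splits)
        then have "summable (\<lambda>m. r m y)"
          unfolding S_def by (intro summable_suminf_not_top) (auto simp: r_def)
        then have "(\<lambda>m. r (m + max N N') y) \<longlonglongrightarrow> 0" by (intro LIMSEQ_ignore_initial_segment summable_LIMSEQ_zero)
        then show "(\<lambda>m. norm (mollify (\<epsilon> (m + max N N')) (g (m + max N N')) y - G y)) \<longlonglongrightarrow> 0"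
          using eq[OF _ y(2)] by (simp add: r_def)
      qed
      show "AE y in \<sigma>. norm (norm (mollify (\<epsilon> (m + max N N')) (g (m + max N N')) y - G y)) \<le> 2 * M N" for m
        using aeG AE_space
      proof eventually_elim
        fix y assume y: "norm (G y) \<le> M N" "y \<in> space \<sigma>"
        let ?k = "m + max N N'"
        \<comment> \<open>The bounds \<open>M m\<close> may grow with \<open>m\<close>, but near \<open>closure U\<close> the cut-off with number \<open>N\<close> can be used throughout.\<close>
        have "mollify (\<epsilon> ?k) (g ?k) y = mollify (\<epsilon> ?k) (g N) y"
        proof (rule mollify_cong[OF \<epsilon>(1)])
          fix z assume "z \<in> cball y (\<epsilon> ?k)"
          moreover have "\<epsilon> ?k \<le> \<delta>" by (rule N') simp
          ultimately have "z \<in> cball y \<delta>" by simp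
          then show "g ?k z = g N z" using N sp[OF y(2)] by auto
        qed
        then have "norm (mollify (\<epsilon> ?k) (g ?k) y) \<le> M N"
          using norm_mollify_le_ess_bound[OF \<epsilon>(1) g_int M] by simp
        then show "norm (norm (mollify (\<epsilon> ?k) (g ?k) y - G y)) \<le> 2 * M N"
          using y(1) norm_triangle_ineq4[of "mollify (\<epsilon> ?k) (g ?k) y" "G y"] by simp
      qed
    qed (use Gm meas[OF measurable_mollify[OF gm]] in auto)
    then have "(\<lambda>m. \<integral>y. norm (mollify (\<epsilon> m) (g m) y - G y) \<partial>\<sigma>) \<longlonglongrightarrow> 0"
      using LIMSEQ_offset[of "\<lambda>m. \<integral>y. norm (mollify (\<epsilon> m) (g m) y - G y) \<partial>\<sigma>" "max N N'" 0] by simp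
    ultimately show ?thesis ..
  qed
  then show ?thesis
    using \<epsilon>(1,2) m\<rho> ae\<rho> Lp unfolding mollification_weight_def by blast
qed

end

section \<open>Passage to the limit\<close>

lemma in_Lp_zero_extension:
  fixes v :: "real^'n::finite \<Rightarrow> 'b::euclidean_space"
  assumes u: "in_Lp p \<Omega> u" and [measurable]: "\<Omega> \<in> sets borel" "v \<in> borel_measurable borel"
    and vu: "AE x in lebesgue_on \<Omega>. v x = u x" and v0: "\<And>x. x \<notin> \<Omega> \<Longrightarrow> v x = 0"
  shows "in_Lp p UNIV v"
proof (cases "p = \<infinity>")
  case True
  then obtain C where "AE x in lebesgue_on \<Omega>. norm (u x) \<le> C" using u by (auto simp: in_Lp_def)
  with vu have "AE x in lebesgue_on \<Omega>. norm (v x) \<le> C" by eventually_elim simp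
  then have "AE x in lebesgue. norm (v x) \<le> max 0 C"
    by (subst (asm) AE_restrict_space_iff) (auto elim!: eventually_mono simp: v0)
  then show ?thesis using True by (subst in_Lp_lborel) (auto simp: AE_completion_iff)
next
  case False
  have "(\<integral>\<^sup>+x. ennreal (norm (v x) powr enn2real p) \<partial>lborel) = (\<integral>\<^sup>+x. ennreal (norm (v x) powr enn2real p) * indicator \<Omega> x \<partial>lborel)"
    using v0 by (intro nn_integral_cong) (auto simp: indicator_def)
  also have "\<dots> = (\<integral>\<^sup>+x. ennreal (norm (v x) powr enn2real p) \<partial>lebesgue_on \<Omega>)"
    by (subst nn_integral_restrict_space) (auto simp: nn_integral_completion)
  also have "\<dots> = (\<integral>\<^sup>+x. ennreal (norm (u x) powr enn2real p) \<partial>lebesgue_on \<Omega>)"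
    by (rule nn_integral_cong_AE) (use vu in \<open>auto elim: eventually_mono\<close>)
  also have "\<dots> < \<infinity>" using u False by (simp add: in_Lp_def)
  finally show ?thesis using False by (subst in_Lp_lborel) auto
qed

lemma in_Lp_dominated:
  fixes v :: "real^'n::finite \<Rightarrow> 'b::euclidean_space" and g :: "real^'n \<Rightarrow> 'c::euclidean_space"
  assumes v: "in_Lp p UNIV v" and p: "1 \<le> p" and [measurable]: "v \<in> borel_measurable borel" "g \<in> borel_measurable borel"
    and le: "\<And>x. norm (g x) \<le> C * norm (v x)" and C: "0 \<le> C"
  shows "in_Lp p UNIV g"
proof (cases "p = \<infinity>")
  case True
  then obtain D where "AE x in lborel. norm (v x) \<le> D" using v by (auto simp: in_Lp_lborel)
  then have "AE x in lborel. norm (g x) \<le> C * D"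
    by eventually_elim (blast intro: order_trans[OF le] mult_left_mono C)
  then show ?thesis using True by (subst in_Lp_lborel) auto
next
  case False
  have "(\<integral>\<^sup>+x. ennreal (norm (g x) powr enn2real p) \<partial>lborel) \<le> (\<integral>\<^sup>+x. ennreal (C powr enn2real p) * ennreal (norm (v x) powr enn2real p) \<partial>lborel)"
  proof (rule nn_integral_mono)
    fix x
    have "norm (g x) powr enn2real p \<le> (C * norm (v x)) powr enn2real p"
      by (intro powr_mono2 le) auto
    then show "ennreal (norm (g x) powr enn2real p) \<le> ennreal (C powr enn2real p) * ennreal (norm (v x) powr enn2real p)"
      using C by (simp add: powr_mult ennreal_mult[symmetric] ennreal_leI)
  qed
  also have "\<dots> = ennreal (C powr enn2real p) * (\<integral>\<^sup>+x. ennreal (norm (v x) powr enn2real p) \<partial>lborel)"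
    by (rule nn_integral_cmult) measurable
  also have "\<dots> < \<infinity>" using v False by (simp add: in_Lp_lborel ennreal_mult_less_top)
  finally show ?thesis using False by (subst in_Lp_lborel) auto
qed

lemma in_Lp_integrable_on_compact:
  fixes v :: "real^'n::finite \<Rightarrow> 'b::euclidean_space"
  assumes v: "in_Lp p UNIV v" and p: "1 \<le> p" and [measurable]: "v \<in> borel_measurable borel" and K: "compact K"
  shows "integrable lborel (\<lambda>x. indicat_real K x *\<^sub>R v x)"
proof -
  have [measurable]: "K \<in> sets borel" using K by (rule borel_compact)
  have iK: "integrable lborel (indicat_real K)"
    using emeasure_bounded_finite[OF compact_imp_bounded[OF K]] by (intro integrable_real_indicator) auto
  show ?thesis
  proof (cases "p = \<infinity>")
    case True
    then obtain D where "AE x in lborel. norm (v x) \<le> D" using v by (auto simp: in_Lp_lborel)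
    then have "AE x in lborel. norm (indicat_real K x *\<^sub>R v x) \<le> norm (D * indicat_real K x)"
      by eventually_elim (auto simp: indicator_def)
    then show ?thesis
      by (intro Bochner_Integration.integrable_bound[OF integrable_mult_right[OF iK, of D]]) measurable
  next
    case False
    have q: "1 \<le> enn2real p" using p False by (metis enn2real_1 enn2real_mono infinity_ennreal_def less_top)
    have "integrable lborel (\<lambda>x. norm (v x) powr enn2real p)"
      using v False by (auto simp: in_Lp_lborel integrable_iff_bounded)
    then have "integrable lborel (\<lambda>x. norm (v x) powr enn2real p + indicat_real K x)" using iK by simp
    then show ?thesis
    proof (rule Bochner_Integration.integrable_bound)
      \<comment> \<open>Hoelder on a set of finite measure, in the elementary form \<open>t \<le> t\<^sup>p + 1\<close>.\<close>
      have "norm (v x) \<le> norm (v x) powr enn2real p + 1" for x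
      proof (cases "norm (v x) \<le> 1")
        case False
        then have "norm (v x) powr 1 \<le> norm (v x) powr enn2real p" using q by (intro powr_mono) auto
        then show ?thesis by simp
      qed (simp add: add_increasing)
      then show "AE x in lborel. norm (indicat_real K x *\<^sub>R v x) \<le> norm (norm (v x) powr enn2real p + indicat_real K x)"
        by (auto simp: indicator_def)
    qed measurable
  qed
qed

lemma mollify_tendsto_set_integral:
  fixes \<beta> :: "'a::euclidean_space \<Rightarrow> real"
  assumes \<beta>: "integrable lborel \<beta>" and \<epsilon>: "\<And>m. 0 < \<epsilon> m" "\<epsilon> \<longlonglongrightarrow> 0" and U: "bounded U" and [measurable]: "U \<in> sets borel"
  shows "(\<lambda>m. \<integral>y. mollify (\<epsilon> m) \<beta> y \<partial>restrict_space lborel U) \<longlonglongrightarrow> (\<integral>y. \<beta> y \<partial>restrict_space lborel U)"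
proof (rule LIMSEQ_I)
  fix e :: real assume "0 < e"
  have [measurable]: "\<beta> \<in> borel_measurable borel" using \<beta> by auto
  have "\<exists>d>0. \<forall>t. 0 < t \<and> t \<le> d \<longrightarrow> (\<integral>\<^sup>+x. ennreal (norm (mollify t \<beta> x - \<beta> x) powr 1) \<partial>lborel) \<le> ennreal (e / 2)"
    using \<open>0 < e\<close> \<beta> by (intro mollify_tendsto_Lp) (auto simp: integrable_iff_bounded)
  then obtain d where d: "0 < d" "\<And>t. 0 < t \<Longrightarrow> t \<le> d \<Longrightarrow> (\<integral>\<^sup>+x. ennreal (norm (mollify t \<beta> x - \<beta> x)) \<partial>lborel) \<le> ennreal (e / 2)"
    by auto
  obtain N where N: "\<And>m. N \<le> m \<Longrightarrow> \<epsilon> m \<le> d"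
    using order_tendstoD(2)[OF \<epsilon>(2) d(1)] unfolding eventually_sequentially by (meson less_imp_le)
  show "\<exists>no. \<forall>m\<ge>no. norm ((\<integral>y. mollify (\<epsilon> m) \<beta> y \<partial>restrict_space lborel U) - (\<integral>y. \<beta> y \<partial>restrict_space lborel U)) < e"
  proof (intro exI[of _ N] allI impI)
    fix m assume m: "N \<le> m"
    have le: "(\<integral>\<^sup>+x. ennreal (norm (mollify (\<epsilon> m) \<beta> x - \<beta> x)) \<partial>lborel) \<le> ennreal (e / 2)"
      by (rule d(2)[OF \<epsilon>(1) N[OF m]])
    have int: "integrable lborel (\<lambda>x. mollify (\<epsilon> m) \<beta> x - \<beta> x)"
      by (rule integrableI_bounded) (use le in \<open>auto intro: le_less_trans\<close>)
    then have "integrable lborel (mollify (\<epsilon> m) \<beta>)"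
      using Bochner_Integration.integrable_add[OF int \<beta>] by simp
    then have iM: "integrable lborel (\<lambda>x. indicat_real U x *\<^sub>R mollify (\<epsilon> m) \<beta> x)"
      by (intro integrable_mult_indicator) auto
    have i\<beta>: "integrable lborel (\<lambda>x. indicat_real U x *\<^sub>R \<beta> x)"
      by (intro integrable_mult_indicator \<beta>) auto
    have "(\<integral>y. mollify (\<epsilon> m) \<beta> y \<partial>restrict_space lborel U) - (\<integral>y. \<beta> y \<partial>restrict_space lborel U)
        = (\<integral>x. indicat_real U x *\<^sub>R (mollify (\<epsilon> m) \<beta> x - \<beta> x) \<partial>lborel)"
      using iM i\<beta> by (subst (1 2) integral_restrict_space) (auto simp: right_diff_distrib)
    also have "norm \<dots> \<le> (\<integral>x. norm (indicat_real U x *\<^sub>R (mollify (\<epsilon> m) \<beta> x - \<beta> x)) \<partial>lborel)"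
      by (rule integral_norm_bound)
    also have "\<dots> \<le> (\<integral>x. norm (mollify (\<epsilon> m) \<beta> x - \<beta> x) \<partial>lborel)"
      by (intro integral_mono integrable_norm integrable_mult_indicator int) (auto simp: indicator_def)
    also have "\<dots> \<le> e / 2"
      using le nn_integral_eq_integral[OF integrable_norm[OF int]] \<open>0 < e\<close> by simp
    also have "\<dots> < e" using \<open>0 < e\<close> by simp
    finally show "norm ((\<integral>y. mollify (\<epsilon> m) \<beta> y \<partial>restrict_space lborel U) - (\<integral>y. \<beta> y \<partial>restrict_space lborel U)) < e" .
  qed
qed

lemma green_domain_normal_component:
  fixes W :: "real^'n::finite \<Rightarrow> 'f::euclidean_space^'n"
  assumes green: "green_domain U \<sigma> \<nu>" and W: "integrable \<sigma> W"
  shows "integrable \<sigma> (\<lambda>y. \<nu> y $ j *\<^sub>R (W y $ j))"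
    and "norm (\<integral>y. \<nu> y $ j *\<^sub>R (W y $ j) \<partial>\<sigma>) \<le> (\<integral>y. norm (W y) \<partial>\<sigma>)"
proof -
  have "AE y in \<sigma>. norm (\<nu> y) = 1" using green by (simp add: green_domain_def)
  then have ae: "AE y in \<sigma>. norm (\<nu> y $ j *\<^sub>R (W y $ j)) \<le> norm (W y)"
  proof eventually_elim
    fix y assume "norm (\<nu> y) = 1"
    then have "\<bar>\<nu> y $ j\<bar> \<le> 1" using component_le_norm_cart[of "\<nu> y" j] by simp
    then have "\<bar>\<nu> y $ j\<bar> * norm (W y $ j) \<le> 1 * norm (W y)"
      by (intro mult_mono Finite_Cartesian_Product.norm_nth_le) auto
    then show "norm (\<nu> y $ j *\<^sub>R (W y $ j)) \<le> norm (W y)" by simp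
  qed
  have Wj: "integrable \<sigma> (\<lambda>y. W y $ j)"
    by (rule integrable_bounded_linear[OF bounded_linear_vec_nth W])
  show int: "integrable \<sigma> (\<lambda>y. \<nu> y $ j *\<^sub>R (W y $ j))"
    by (rule Bochner_Integration.integrable_bound[OF W _ ae])
       (rule borel_measurable_scaleR[OF borel_measurable_integrable[OF green_domain_integrable_normal[OF green]]
          borel_measurable_integrable[OF Wj]])
  have "norm (\<integral>y. \<nu> y $ j *\<^sub>R (W y $ j) \<partial>\<sigma>) \<le> (\<integral>y. norm (\<nu> y $ j *\<^sub>R (W y $ j)) \<partial>\<sigma>)"
    by (rule integral_norm_bound)
  also have "\<dots> \<le> (\<integral>y. norm (W y) \<partial>\<sigma>)"
    by (intro integral_mono_AE integrable_norm int W ae)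
  finally show "norm (\<integral>y. \<nu> y $ j *\<^sub>R (W y $ j) \<partial>\<sigma>) \<le> (\<integral>y. norm (W y) \<partial>\<sigma>)" .
qed

lemma exhaustion_absorbs_neighbourhood:
  fixes C :: "nat \<Rightarrow> 'a::euclidean_space set"
  assumes C: "\<And>n. C n \<subseteq> interior (C (Suc n))" "\<And>K. compact K \<Longrightarrow> K \<subseteq> \<Omega> \<Longrightarrow> \<exists>N. \<forall>n\<ge>N. K \<subseteq> C n"
    and L: "compact L" "L \<subseteq> \<Omega>"
  shows "\<exists>N. \<exists>\<delta>>0. \<forall>n\<ge>N. (\<Union>x\<in>L. cball x \<delta>) \<subseteq> C n"
proof -
  obtain N where N: "L \<subseteq> C N" using C(2)[OF L] by blast
  have mono: "C m \<subseteq> C n" if "m \<le> n" for m n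
    by (rule lift_Suc_mono_le[of C, OF _ that]) (rule order_trans[OF C(1) interior_subset])
  have "L \<subseteq> interior (C (Suc N))" using N C(1) by blast
  from compact_subset_open_imp_cball_epsilon_subset[OF L(1) open_interior this]
  obtain \<delta> where "0 < \<delta>" "(\<Union>x\<in>L. cball x \<delta>) \<subseteq> interior (C (Suc N))" by blast
  then show ?thesis
    using mono interior_subset by (intro exI[of _ "Suc N"] exI[of _ \<delta>]) blast
qed

text \<open>The mollified identity is applied to the cut-off with number \<open>m\<close> at the scale \<open>\<epsilon> m\<close>, for all large
\<open>m\<close>, and \<open>m\<close> tends to infinity. The representative \<open>u'\<close> replaces \<open>u\<close> from the start: it is the
function whose values on the boundaries matter, and it is a Borel function.\<close>

theorem theorem4p15:
  fixes p :: ennreal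
    and \<Omega> :: "(real^'n::finite) set"
    and A :: "'n \<Rightarrow> real^'n \<Rightarrow> 'e::euclidean_space \<Rightarrow>\<^sub>L 'f::euclidean_space"
    and B :: "real^'n \<Rightarrow> 'e \<Rightarrow>\<^sub>L 'f"
    and u u' :: "real^'n \<Rightarrow> 'e"
  assumes "1 \<le> p"
    and "open \<Omega>" and "connected \<Omega>"
    and "\<And>j. smooth_on (A j) \<Omega>" and "smooth_on B \<Omega>"
    and "in_Lp p \<Omega> u"
    and "weak_extension p \<Omega> A B u (\<lambda>_. 0)"
    and borel_representative: "u' \<in> borel_measurable (restrict_space borel \<Omega>)"
      "AE x in lebesgue_on \<Omega>. u' x = u x"
  shows "p_ae_green_domain p \<Omega> (\<lambda>U \<sigma> \<nu>.
           integrable \<sigma> (\<lambda>x. principal_symbol A x (\<nu> x) (u' x)) \<and>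
           (\<integral>x. principal_symbol A x (\<nu> x) (u' x) \<partial>\<sigma>)
             + (\<integral>x. (B x - div_symbol A x) (u x) \<partial>lebesgue_on U) = 0)"
proof -
  note p = assms(1) and \<Omega> = assms(2) and A = assms(4) and B = assms(5)
  have \<Omega>b[measurable]: "\<Omega> \<in> sets borel" using \<Omega> by simp
  define v where "v x = indicat_real \<Omega> x *\<^sub>R u' x" for x
  have v[measurable]: "v \<in> borel_measurable borel"
    using borel_representative(1) unfolding v_def by (subst (asm) borel_measurable_restrict_space_iff) auto
  have "AE x in lebesgue_on \<Omega>. x \<in> \<Omega>" using AE_space[of "lebesgue_on \<Omega>"] by simp
  with borel_representative(2) have vu: "AE x in lebesgue_on \<Omega>. v x = u x"
    by eventually_elim (simp add: v_def)
  have v_Lp: "in_Lp p UNIV v"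
    by (rule in_Lp_zero_extension[OF assms(6) \<Omega>b v vu]) (simp add: v_def)
  have weak: "(\<integral>x. u x \<bullet> formal_adjoint A B \<phi> x \<partial>lebesgue_on \<Omega>) = 0" if "C1_compact_support \<Omega> \<phi>" for \<phi>
    using assms(7) that by (simp add: weak_extension_def)
  obtain C where C: "\<And>n. compact (C n)" "\<And>n. C n \<subseteq> \<Omega>" "\<And>n. C n \<subseteq> interior (C (Suc n))"
      "\<And>K. compact K \<Longrightarrow> K \<subseteq> \<Omega> \<Longrightarrow> \<exists>N. \<forall>n\<ge>N. K \<subseteq> C n"
    using open_Union_compact_subsets[OF \<Omega>] by metis
  have exhaust: "\<exists>N. \<exists>\<delta>>0. \<forall>n\<ge>N. (\<Union>x\<in>L. cball x \<delta>) \<subseteq> C n" if "compact L" "L \<subseteq> \<Omega>" for L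
    by (rule exhaustion_absorbs_neighbourhood[of C \<Omega> L]) (fact C(3,4) that)+
  have contA: "continuous_on (C m) (A j)" for m j
    using A C(2) by (blast intro: continuous_on_subset smooth_on_continuous)
  have contB: "continuous_on (C m) (\<lambda>x. B x - div_symbol A x)" for m
    using A B C(2) by (blast intro: continuous_on_subset continuous_on_diff smooth_on_continuous continuous_on_div_symbol)
  have v_int: "integrable lborel (\<lambda>x. indicat_real (C m) x *\<^sub>R v x)" for m
    by (rule in_Lp_integrable_on_compact[OF v_Lp p v C(1)])

  \<comment> \<open>The functions \<open>A\<^sub>j u\<close> are collected in one vector field, so that one weight controls all of them.\<close>
  define G :: "real^'n \<Rightarrow> 'f^'n" where "G x = (\<chi> j. A j x (v x))" for x
  define g where "g m x = indicat_real (C m) x *\<^sub>R G x" for m x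
  have g_meas: "g m \<in> borel_measurable borel" for m
  proof (subst borel_measurable_euclidean_space, intro ballI)
    fix i :: "'f^'n" assume "i \<in> Basis"
    then obtain j b where i: "i = axis j b" by (auto simp: Basis_vec_def)
    have "(\<lambda>x. (indicat_real (C m) x *\<^sub>R A j x (v x)) \<bullet> b) \<in> borel_measurable borel"
      by (intro borel_measurable_inner measurable_indicator_blinfun_apply contA C v) simp
    then show "(\<lambda>x. g m x \<bullet> i) \<in> borel_measurable borel"
      by (simp add: i inner_axis g_def G_def)
  qed
  have g_bound: "\<exists>M\<ge>0. \<forall>x. norm (g m x) \<le> M * norm (v x)" for m
  proof -
    obtain M where M: "\<And>j. 0 \<le> M j" "\<And>j x w. x \<in> C m \<Longrightarrow> norm (A j x w) \<le> M j * norm w"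
      using compact_blinfun_bound[OF contA C(1)] by metis
    have "norm (g m x) \<le> (\<Sum>j\<in>UNIV. M j) * norm (v x)" for x
    proof (cases "x \<in> C m")
      case True
      have "norm (G x) \<le> (\<Sum>j\<in>UNIV. norm (G x $ j))"
        unfolding norm_vec_def by (rule L2_set_le_sum) simp
      also have "\<dots> \<le> (\<Sum>j\<in>UNIV. M j * norm (v x))"
        unfolding G_def by (intro sum_mono) (simp add: M(2)[OF True])
      finally show ?thesis using True by (simp add: g_def sum_distrib_right)
    qed (simp add: g_def M(1) sum_nonneg)
    then show ?thesis by (intro exI[of _ "\<Sum>j\<in>UNIV. M j"]) (simp add: M(1) sum_nonneg)
  qed
  have g_Lp: "in_Lp p UNIV (g m)" for m
    using g_bound[of m] in_Lp_dominated[OF v_Lp p v g_meas] by blast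
  have g_int: "integrable lborel (g m)" for m
  proof -
    have "(\<lambda>x. indicat_real (C m) x *\<^sub>R g m x) = g m" by (auto simp: g_def indicator_def)
    then show ?thesis using in_Lp_integrable_on_compact[OF g_Lp p g_meas C(1), of m m] by simp
  qed

  have "\<exists>\<epsilon> \<rho>. (\<forall>m. 0 < \<epsilon> m) \<and> \<epsilon> \<longlonglongrightarrow> 0 \<and> mollification_weight p \<Omega> \<epsilon> g G \<rho>"
  proof (cases "p = \<infinity>")
    case True
    show ?thesis unfolding True
    proof (rule mollification_weight_infinite_exponent[of \<Omega> C g G])
      show "\<exists>M. AE x in lborel. norm (g m x) \<le> M" for m
        using g_Lp[of m] True by (simp add: in_Lp_lborel g_meas)
    qed (fact exhaust g_def g_int)+
  next
    case False
    show ?thesis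
    proof (rule mollification_weight_finite_exponent[of \<Omega> C g G])
      show "(\<integral>\<^sup>+x. ennreal (norm (g m x) powr enn2real p) \<partial>lborel) < \<infinity>" for m
        using g_Lp[of m] False by (simp add: in_Lp_lborel g_meas)
    qed (fact exhaust g_def g_int p False)+
  qed
  then obtain \<epsilon> \<rho> where \<epsilon>: "\<And>m. 0 < \<epsilon> m" "\<epsilon> \<longlonglongrightarrow> 0" and \<rho>: "mollification_weight p \<Omega> \<epsilon> g G \<rho>"
    by blast

  have formula: "integrable \<sigma> (\<lambda>x. principal_symbol A x (\<nu> x) (u' x)) \<and>
           (\<integral>x. principal_symbol A x (\<nu> x) (u' x) \<partial>\<sigma>)
             + (\<integral>x. (B x - div_symbol A x) (u x) \<partial>lebesgue_on U) = 0"
    if green: "green_domain U \<sigma> \<nu>" and U\<Omega>: "closure U \<subseteq> \<Omega>" and fin: "(\<integral>\<^sup>+y. \<rho> y \<partial>\<sigma>) < \<infinity>" for U \<sigma> \<nu>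
  proof -
    have G_int: "integrable \<sigma> G" and G_lim: "(\<lambda>m. \<integral>y. norm (mollify (\<epsilon> m) (g m) y - G y) \<partial>\<sigma>) \<longlonglongrightarrow> 0"
      using \<rho> green U\<Omega> fin unfolding mollification_weight_def by blast+
    interpret finite_measure \<sigma> using green by (simp add: green_domain_def)
    have U: "bounded U" "open U" using green by (auto simp: green_domain_def)
    then have Ub[measurable]: "U \<in> sets borel" by simp
    have cU: "compact (closure U)" using U by simp
    obtain N \<delta> where "0 < \<delta>" and N: "\<And>m. N \<le> m \<Longrightarrow> (\<Union>x\<in>closure U. cball x \<delta>) \<subseteq> C m"
      using exhaust[OF cU U\<Omega>] by blast
    \<comment> \<open>The volume term near \<open>closure U\<close>; there the cut-off at \<open>C N\<close> has no effect.\<close>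
    define h where "h x = indicat_real (C N) x *\<^sub>R (B x - div_symbol A x) (v x)" for x
    have h_int: "integrable lborel h"
      unfolding h_def by (rule integrable_indicator_blinfun_apply[OF contB C(1) v v_int])
    define M where "M m = mollify (\<epsilon> m) (g m)" for m
    have M_int: "integrable \<sigma> (M m)" for m
      unfolding M_def
      by (rule integrable_const_bound[OF AE_I2[OF norm_mollify_le[OF \<epsilon>(1) g_int]]])
         (rule measurable_on_green_boundary[OF green measurable_mollify[OF g_meas]])
    define I where "I W = (\<Sum>j\<in>UNIV. \<integral>y. \<nu> y $ j *\<^sub>R (W y $ j) \<partial>\<sigma>)" for W :: "real^'n \<Rightarrow> 'f^'n"
    have I_lim: "(\<lambda>m. I (M m)) \<longlonglongrightarrow> I G"
      unfolding I_def
    proof (rule tendsto_sum, rule LIM_zero_cancel, rule Lim_null_comparison[OF _ G_lim], intro always_eventually allI)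
      fix j m
      have d: "integrable \<sigma> (\<lambda>y. M m y - G y)" using M_int G_int by simp
      have "(\<integral>y. \<nu> y $ j *\<^sub>R (M m y $ j) \<partial>\<sigma>) - (\<integral>y. \<nu> y $ j *\<^sub>R (G y $ j) \<partial>\<sigma>)
          = (\<integral>y. \<nu> y $ j *\<^sub>R ((M m y - G y) $ j) \<partial>\<sigma>)"
        using green_domain_normal_component(1)[OF green M_int[of m], of j] green_domain_normal_component(1)[OF green G_int, of j]
        by (simp add: scaleR_diff_right)
      also have "norm \<dots> \<le> (\<integral>y. norm (M m y - G y) \<partial>\<sigma>)"
        by (rule green_domain_normal_component(2)[OF green d])
      finally show "norm ((\<integral>y. \<nu> y $ j *\<^sub>R (M m y $ j) \<partial>\<sigma>) - (\<integral>y. \<nu> y $ j *\<^sub>R (G y $ j) \<partial>\<sigma>))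
          \<le> (\<integral>y. norm (mollify (\<epsilon> m) (g m) y - G y) \<partial>\<sigma>)"
        by (simp add: M_def)
    qed

    have "(I G + (\<integral>x. indicat_real U x *\<^sub>R h x \<partial>lborel)) \<bullet> f = 0" for f
    proof -
      define \<beta> where "\<beta> x = h x \<bullet> f" for x
      have \<beta>_int: "integrable lborel \<beta>" unfolding \<beta>_def using h_int by simp
      have "\<forall>\<^sub>F m in sequentially. N \<le> m \<and> \<epsilon> m < \<delta>"
        by (intro eventually_conj eventually_ge_at_top order_tendstoD(2)[OF \<epsilon>(2) \<open>0 < \<delta>\<close>])
      then have vanish: "\<forall>\<^sub>F m in sequentially. I (M m) \<bullet> f + (\<integral>y. mollify (\<epsilon> m) \<beta> y \<partial>restrict_space lborel U) = 0"
      proof eventually_elim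
        fix m assume m: "N \<le> m \<and> \<epsilon> m < \<delta>"
        have UC: "(\<Union>x\<in>closure U. cball x (\<epsilon> m)) \<subseteq> C m"
          using N[of m] m by (auto simp: subset_eq)
        have identity: "(\<Sum>j\<in>UNIV. \<integral>y. \<nu> y $ j * mollify (\<epsilon> m) (\<lambda>x. (indicat_real (C m) x *\<^sub>R A j x (v x)) \<bullet> f) y \<partial>\<sigma>)
          + (\<integral>y. mollify (\<epsilon> m) (\<lambda>x. (indicat_real (C m) x *\<^sub>R (B x - div_symbol A x) (v x)) \<bullet> f) y \<partial>restrict_space lborel U) = 0"
          by (rule mollified_green_identity[OF \<Omega> A B weak v vu C(1,2) v_int green \<epsilon>(1) UC])
        have "mollify (\<epsilon> m) (\<lambda>x. (indicat_real (C m) x *\<^sub>R A j x (v x)) \<bullet> f) y = (M m y $ j) \<bullet> f" for j y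
        proof -
          have T: "bounded_linear (\<lambda>w :: 'f^'n. (w $ j) \<bullet> f)"
            by (intro bounded_linear_compose[OF bounded_linear_inner_left] bounded_linear_vec_nth)
          show ?thesis
            unfolding M_def bounded_linear_mollify[OF T \<epsilon>(1) g_int] by (simp add: g_def G_def)
        qed
        then have "(\<integral>y. \<nu> y $ j * mollify (\<epsilon> m) (\<lambda>x. (indicat_real (C m) x *\<^sub>R A j x (v x)) \<bullet> f) y \<partial>\<sigma>)
            = (\<integral>y. \<nu> y $ j *\<^sub>R (M m y $ j) \<partial>\<sigma>) \<bullet> f" for j
          using integral_inner_left[OF green_domain_normal_component(1)[OF green M_int[of m], of j], of f] by simp
        moreover have "(\<integral>y. mollify (\<epsilon> m) (\<lambda>x. (indicat_real (C m) x *\<^sub>R (B x - div_symbol A x) (v x)) \<bullet> f) y \<partial>restrict_space lborel U)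
           = (\<integral>y. mollify (\<epsilon> m) \<beta> y \<partial>restrict_space lborel U)"
        proof (rule Bochner_Integration.integral_cong[OF refl], rule mollify_cong[OF \<epsilon>(1)])
          fix y z assume "y \<in> space (restrict_space lborel U)" "z \<in> cball y (\<epsilon> m)"
          then have "y \<in> closure U" "z \<in> cball y \<delta>"
            using m closure_subset by (auto simp: space_restrict_space)
          then have "z \<in> C m" "z \<in> C N" using N[of m] N[of N] m by blast+
          then show "(indicat_real (C m) z *\<^sub>R (B z - div_symbol A z) (v z)) \<bullet> f = \<beta> z"
            by (simp add: \<beta>_def h_def)
        qed
        ultimately show "I (M m) \<bullet> f + (\<integral>y. mollify (\<epsilon> m) \<beta> y \<partial>restrict_space lborel U) = 0"
          using identity by (simp add: I_def inner_sum_left)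
      qed
      have "(\<lambda>m. I (M m) \<bullet> f + (\<integral>y. mollify (\<epsilon> m) \<beta> y \<partial>restrict_space lborel U))
          \<longlonglongrightarrow> I G \<bullet> f + (\<integral>y. \<beta> y \<partial>restrict_space lborel U)"
        by (intro tendsto_add tendsto_inner I_lim tendsto_const mollify_tendsto_set_integral \<beta>_int \<epsilon> U Ub)
      from LIMSEQ_unique[OF this tendsto_eventually[OF vanish]]
      have "I G \<bullet> f + (\<integral>y. \<beta> y \<partial>restrict_space lborel U) = 0" .
      moreover have "(\<integral>y. \<beta> y \<partial>restrict_space lborel U) = (\<integral>x. indicat_real U x *\<^sub>R h x \<partial>lborel) \<bullet> f"
      proof -
        have "integrable lborel (\<lambda>x. indicat_real U x *\<^sub>R h x)"
          by (intro integrable_mult_indicator h_int) simp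
        from integral_inner_left[OF this, of f] show ?thesis
          by (subst integral_restrict_space) (auto simp: \<beta>_def)
      qed
      ultimately show ?thesis by (simp add: inner_add_left)
    qed
    then have zero: "I G + (\<integral>x. indicat_real U x *\<^sub>R h x \<partial>lborel) = 0"
      using inner_eq_zero_iff by blast
    have symbol: "principal_symbol A y (\<nu> y) (u' y) = (\<Sum>j\<in>UNIV. \<nu> y $ j *\<^sub>R (G y $ j))" if "y \<in> space \<sigma>" for y
    proof -
      have "y \<in> \<Omega>" using that U\<Omega> by (auto simp: green_domain_space[OF green] frontier_def)
      then show ?thesis
        by (simp add: principal_symbol_def blinfun.sum_left blinfun.scaleR_left G_def v_def)
    qed
    have "integrable \<sigma> (\<lambda>y. \<Sum>j\<in>UNIV. \<nu> y $ j *\<^sub>R (G y $ j))"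
      by (intro Bochner_Integration.integrable_sum green_domain_normal_component(1)[OF green G_int])
    then have "integrable \<sigma> (\<lambda>y. principal_symbol A y (\<nu> y) (u' y))"
      by (subst Bochner_Integration.integrable_cong[OF refl symbol])
    moreover have "(\<integral>y. principal_symbol A y (\<nu> y) (u' y) \<partial>\<sigma>) = I G"
      unfolding I_def using green_domain_normal_component(1)[OF green G_int]
      by (subst Bochner_Integration.integral_cong[OF refl symbol]) (auto intro: Bochner_Integration.integral_sum)
    moreover have "(\<integral>x. (B x - div_symbol A x) (u x) \<partial>lebesgue_on U) = (\<integral>x. indicat_real U x *\<^sub>R h x \<partial>lborel)"
    proof (rule integral_lebesgue_on_eq_AE[OF Ub])
      show "h \<in> borel_measurable borel" using h_int by auto
      have "AE x in lebesgue. x \<in> \<Omega> \<longrightarrow> v x = u x" using vu by (subst (asm) AE_restrict_space_iff) auto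
      then show "AE x in lebesgue_on U. (B x - div_symbol A x) (u x) = h x"
      proof (subst AE_restrict_space_iff, goal_cases)
        case 2
        then show ?case
        proof eventually_elim
          fix x assume x: "x \<in> \<Omega> \<longrightarrow> v x = u x"
          show "x \<in> U \<longrightarrow> (B x - div_symbol A x) (u x) = h x"
          proof
            assume "x \<in> U"
            then have "x \<in> closure U" using closure_subset by blast
            then have "x \<in> \<Omega>" "x \<in> C N" using U\<Omega> N[of N] \<open>0 < \<delta>\<close> by force+
            then show "(B x - div_symbol A x) (u x) = h x" using x by (simp add: h_def)
          qed
        qed
      qed simp
    qed
    ultimately show ?thesis using zero by simp
  qed

  define \<E> where "\<E> = {U. \<exists>\<sigma> \<nu>. green_domain U \<sigma> \<nu> \<and> (\<integral>\<^sup>+x. \<rho> x \<partial>\<sigma>) = \<infinity>}"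
  have "p_exceptional p \<E>"
    using \<rho> unfolding p_exceptional_def mollification_weight_def \<E>_def by (intro exI[of _ \<rho>]) auto
  moreover have "(\<integral>\<^sup>+y. \<rho> y \<partial>\<sigma>) < \<infinity>" if "green_domain U \<sigma> \<nu>" "U \<notin> \<E>" for U \<sigma> \<nu>
    using that by (auto simp: \<E>_def less_top)
  ultimately show ?thesis
    unfolding p_ae_green_domain_def using formula by (intro exI[of _ \<E>]) blast
qed

end
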